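(* Assume: (1) $(X_i,Y_i)_{i=1}^n$ are i.i.d. copies of $(X,Y)$, where $Y=\langle\beta,X\rangle+\varepsilon$ with $\mathbb{E}[\varepsilon X]=0$, $\mathbb{E}[X]=0$, $\mathbb{E}\|X\|^4<\infty$ and $\mathbb{E}[\varepsilon^2\mid X]\le\sigma^2<\infty$; (2) the covariance operator $K=\mathbb{E}[X\otimes X]$ has no zero eigenvalues; (3) for some $\mu,R,C>0$, $\sum_{j\ge1}\langle\beta,v_j\rangle^2/\lambda_j^{2\mu}\le R^2$ and $\sum_{j\ge1}\lambda_j\le C$. Let $\hat\beta_m$ be the functional PLS estimator with $m=m_n$ components and $\hat Q_m$ its residual polynomial. Then for every $s\in[0,1]$, as $n\to\infty$, $$\left\|K^s(\hat\beta_m-\beta)\right\|^2=O_P\left(|\hat Q_m'(0)|^{2(1-s)}n^{-1}+|\hat Q_m'(0)|^{-2(\mu+s)}+|\hat Q_m'(0)|^{-2s}n^{-(\mu\wedge1)}\right),$$ provided that $|\hat Q_m'(0)|=O_P(n^{1/2})$.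
   Context: $(\mathbb{H},\langle\cdot,\cdot\rangle)$ is a separable real Hilbert space with norm $\|\cdot\|$; $X,\beta\in\mathbb{H}$, $Y,\varepsilon\in\mathbb{R}$. For $x\in\mathbb{H}$, $(x\otimes x)b=\langle x,b\rangle x$. $K=\mathbb{E}[X\otimes X]=\sum_{j\ge1}\lambda_j v_j\otimes v_j$ is the covariance operator, with eigenvalues $\lambda_1\ge\lambda_2\ge\dots\ge0$ and orthonormal eigenvectors $v_j$; $K^s=\sum_j\lambda_j^s v_j\otimes v_j$ with $K^0=I$. Write $a\wedge b=\min\{a,b\}$. Sample quantities: $\hat r=\frac1n\sum_{i=1}^nY_iX_i$, $\hat K=\frac1n\sum_{i=1}^nX_i\otimes X_i$, and $n_*\le n$ is the number of distinct non-zero eigenvalues of $\hat K$. PLS estimator: for $m\ge1$, $\hat\beta_m$ is the minimizer of $\|\hat r-\hat Kb\|^2$ over $b$ in the Krylov subspace $\mathbb{H}_m=\mathrm{span}\{\hat r,\hat K\hat r,\dots,\hat K^{m-1}\hat r\}$. Write $\hat\beta_m=\hat P_m(\hat K)\hat r$ with $\hat P_m$ a polynomial of degree at most $m-1$, and let $\hat Q_m(\lambda)=1-\lambda\hat P_m(\lambda)$ be the residual polynomial, so $\hat r-\hat K\hat\beta_m=\hat Q_m(\hat K)\hat r$. Equivalently, $\hat Q_m$ minimizes $\|\phi(\hat K)\hat r\|$ over polynomials $\phi$ of degree at most $m$ with $\phi(0)=1$. Throughout $1\le m\le n_*$, and $\hat Q_m$ is taken to have $m$ distinct real roots $\hat\theta_1>\dots>\hat\theta_m>0$,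 so that $|\hat Q_m'(0)|=\sum_{j=1}^m1/\hat\theta_j$. $A_n=O_P(B_n)$ for (possibly random) positive $B_n$ means that $A_n/B_n$ is bounded in probability. *)

theory Defs
  imports "HOL-Probability.Probability" "HOL-Computational_Algebra.Polynomial"
begin

definition tensor_sq :: "'h::real_inner \<Rightarrow> 'h \<Rightarrow> 'h" where
  "tensor_sq x b = (x \<bullet> b) *\<^sub>R x"

(* The operator-valued expectation of X tensor X, applied to b: evaluation at b commutes with
   the expectation, so this is a Bochner integral in the Hilbert space itself. *)
definition covariance_op :: "'w measure \<Rightarrow> ('w \<Rightarrow> 'h::{real_inner, banach, second_countable_topology}) \<Rightarrow> 'h \<Rightarrow> 'h" where
  "covariance_op M X b = (\<integral>\<omega>. tensor_sq (X \<omega>) b \<partial>M)"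

definition is_eigenvalue :: "('h::real_vector \<Rightarrow> 'h) \<Rightarrow> real \<Rightarrow> bool" where
  "is_eigenvalue A c \<longleftrightarrow> (\<exists>b. b \<noteq> 0 \<and> A b = c *\<^sub>R b)"

(* The Hilbert space may be finite-dimensional, so the index set J is either all j >= 1 or an
   initial segment {1..d}. *)
definition spectral_decomposition ::
    "('h::real_inner \<Rightarrow> 'h) \<Rightarrow> nat set \<Rightarrow> (nat \<Rightarrow> real) \<Rightarrow> (nat \<Rightarrow> 'h) \<Rightarrow> bool" where
  "spectral_decomposition A J lam v \<longleftrightarrow>
     (J = {1..} \<or> (\<exists>d. J = {1..d})) \<and>
     (\<forall>i\<in>J. \<forall>j\<in>J. i \<le> j \<longrightarrow> lam j \<le> lam i) \<and>
     (\<forall>j\<in>J. 0 \<le> lam j) \<and>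
     (\<forall>i\<in>J. \<forall>j\<in>J. v i \<bullet> v j = (if i = j then 1 else 0)) \<and>
     (\<forall>b. ((\<lambda>j. lam j *\<^sub>R tensor_sq (v j) b) has_sum A b) J)"

definition op_powr ::
    "nat set \<Rightarrow> (nat \<Rightarrow> real) \<Rightarrow> (nat \<Rightarrow> 'h::real_inner) \<Rightarrow> real \<Rightarrow> 'h \<Rightarrow> 'h" where
  "op_powr J lam v s b =
     (if s = 0 then b else (\<Sum>\<^sub>\<infinity>j\<in>J. (lam j powr s) *\<^sub>R tensor_sq (v j) b))"

definition r_hat :: "(nat \<Rightarrow> 'w \<Rightarrow> 'h::real_inner) \<Rightarrow> (nat \<Rightarrow> 'w \<Rightarrow> real) \<Rightarrow> nat \<Rightarrow> 'w \<Rightarrow> 'h" where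
  "r_hat Xs Ys n \<omega> = (1 / real n) *\<^sub>R (\<Sum>i=1..n. Ys i \<omega> *\<^sub>R Xs i \<omega>)"

definition K_hat :: "(nat \<Rightarrow> 'w \<Rightarrow> 'h::real_inner) \<Rightarrow> nat \<Rightarrow> 'w \<Rightarrow> 'h \<Rightarrow> 'h" where
  "K_hat Xs n \<omega> b = (1 / real n) *\<^sub>R (\<Sum>i=1..n. tensor_sq (Xs i \<omega>) b)"

definition num_nonzero_eigenvalues :: "('h::real_vector \<Rightarrow> 'h) \<Rightarrow> nat" where
  "num_nonzero_eigenvalues A = card {c. c \<noteq> 0 \<and> is_eigenvalue A c}"

definition krylov :: "('h::real_vector \<Rightarrow> 'h) \<Rightarrow> 'h \<Rightarrow> nat \<Rightarrow> 'h set" where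
  "krylov A r m = span {(A ^^ j) r | j. j < m}"

(* For A = K_hat and r = r_hat the minimizer exists and is unique: r_hat lies in the range of
   K_hat, and K_hat is injective there. *)
definition pls :: "('h::real_inner \<Rightarrow> 'h) \<Rightarrow> 'h \<Rightarrow> nat \<Rightarrow> 'h" where
  "pls A r m = arg_min_on (\<lambda>b. (norm (r - A b))\<^sup>2) (krylov A r m)"

definition poly_op :: "real poly \<Rightarrow> ('h::real_vector \<Rightarrow> 'h) \<Rightarrow> 'h \<Rightarrow> 'h" where
  "poly_op p A x = (\<Sum>i\<le>degree p. coeff p i *\<^sub>R (A ^^ i) x)"

(* A predicate and not a function, because Q need not be unique when the Krylov space has
   dimension smaller than m. The polynomial pCons 0 P is t * P(t). *)
definition is_residual_poly :: "('h::real_inner \<Rightarrow> 'h) \<Rightarrow> 'h \<Rightarrow> nat \<Rightarrow> real poly \<Rightarrow> bool" where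
  "is_residual_poly A r m Q \<longleftrightarrow>
     (\<exists>P. degree P < m \<and> pls A r m = poly_op P A r \<and> Q = 1 - pCons 0 P)"

(* A_n = O_P(B_n) as n tends to infinity. For measurable A_n and B_n the clause with E says
   exactly that |A_n| > c B_n has probability at most eps. The covering event E avoids the
   convention that a non-measurable set has measure 0. *)
definition O_P :: "'w measure \<Rightarrow> (nat \<Rightarrow> 'w \<Rightarrow> real) \<Rightarrow> (nat \<Rightarrow> 'w \<Rightarrow> real) \<Rightarrow> bool" where
  "O_P M A B \<longleftrightarrow>
     (\<forall>eps>0. \<exists>c. \<forall>\<^sub>F n in sequentially.
        \<exists>E\<in>sets M. {\<omega> \<in> space M. \<bar>A n \<omega>\<bar> > c * B n \<omega>} \<subseteq> E \<and> measure M E \<le> eps)"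

definition with_prob_tending_to_1 :: "'w measure \<Rightarrow> (nat \<Rightarrow> 'w \<Rightarrow> bool) \<Rightarrow> bool" where
  "with_prob_tending_to_1 M P \<longleftrightarrow>
     (\<exists>E. (\<forall>n. E n \<in> sets M) \<and> (\<forall>n. \<forall>\<omega>\<in>E n. P n \<omega>) \<and>
          (\<lambda>n. measure M (E n)) \<longlonglongrightarrow> 1)"

end

theory Submission
  imports Defs "HOL-Computational_Algebra.Fundamental_Theorem_Algebra"
begin

text \<open>
  Write \<open>A\<close> for the sample covariance operator, \<open>r\<close> for the sample cross-covariance, \<open>b\<close> for the
  estimator, \<open>e = b - \<beta>\<close>, \<open>q = |Q'(0)|\<close> and \<open>d = n^(-1/2)\<close>.  Then \<open>r = A \<beta> + noise\<close>, and up to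
  constants the claimed rate is \<open>q^(2-2s) B\<^sup>2\<close> with \<open>B = d + (q^(-\<mu>) + d\<^sup>\<kappa>) / q\<close> and \<open>\<kappa> = min \<mu> 1\<close>.  It is
  therefore enough to treat the two ends, \<open>\<parallel>e\<parallel> \<lesssim> q B\<close> and \<open>\<parallel>K e\<parallel> \<lesssim> B\<close>: on each eigenvector
  \<open>(q \<lambda>)^(2s) \<le> 1 + (q \<lambda>)\<^sup>2\<close>, which gives all \<open>s\<close> between 0 and 1 (\<open>op_powr_interpolation\<close>).

  Both ends are deterministic consequences of three events whose probability is close to 1: the noise
  and \<open>K - A\<close> are \<open>O(d)\<close> in norm, and \<open>q d\<close> is bounded (\<open>pls_error_bound\<close>).

  \<^item> The operator \<open>A\<close> has finite rank, so it has a resolution of the identity and every function of \<open>A\<close>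
    makes sense (\<open>finite_rank_spectral_resolution\<close>).  Since \<open>b\<close> is a minimizer, \<open>r - A b\<close> is
    orthogonal to the image of the Krylov space.  Testing this with \<open>Q(t) / (\<theta> - t)\<close>, where \<open>\<theta>\<close> is the
    smallest root of \<open>Q\<close>, bounds the residual by \<open>\<parallel>\<phi>(A) r\<parallel>\<close>, where \<open>\<phi>\<close> vanishes from \<open>\<theta>\<close> on and
    decays like \<open>exp (- q t / 2)\<close> (\<open>residual_norm_le_damped\<close>, \<open>damped_bound\<close>).

  \<^item> The error \<open>e\<close> is split at the spectral level \<open>1/q\<close> of \<open>A\<close>.  Above it \<open>q A \<ge> 1\<close>, so the error is at
    most \<open>q \<parallel>A e\<parallel>\<close>, the residual up to noise; below it \<open>0 \<le> Q \<le> 1\<close>, and the noise is amplified at most by \<open>q\<close>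
    (\<open>error_bound\<close>).

  \<^item> The source condition speaks of powers of \<open>K\<close>, but the bounds need functions of \<open>A\<close>.  As \<open>1/q\<close> is not
    smaller than the order of \<open>\<parallel>K - A\<parallel>\<close>, one can pass from \<open>K\<close> to \<open>A\<close> through integer powers only
    (\<open>source_transfer\<close>); this costs at most a multiple of \<open>d\<^sup>\<kappa>\<close>.

  The probabilistic input is the variance of a sample mean.  Parseval's identity in the eigenbasis of
  \<open>K\<close> reduces it to real variables, for the noise as well as for the Hilbert-Schmidt norm of \<open>K - A\<close>
  (\<open>sample_mean_variance_vector\<close>), and Markov's inequality turns it into events.
\<close>

section \<open>Polynomials of an operator and finite-rank self-adjoint operators\<close>

lemma poly_op_eq_sum:
  assumes "degree p \<le> N"
  shows "poly_op p A x = (\<Sum>i\<le>N. coeff p i *\<^sub>R (A ^^ i) x)"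
  unfolding poly_op_def
  by (rule sum.mono_neutral_left) (use assms in \<open>auto simp: coeff_eq_0\<close>)

lemma linear_funpow: "linear A \<Longrightarrow> linear ((A::'a::real_vector \<Rightarrow> 'a) ^^ k)"
proof (induction k)
  case 0 then show ?case by (simp add: linear_id[unfolded id_def] id_def)
next
  case (Suc k) then show ?case using linear_compose[of "A ^^ k" A] by (simp add: o_def)
qed

lemma poly_op_add: "linear A \<Longrightarrow> poly_op (p + q) A x = poly_op p A x + poly_op q A x"
proof -
  assume A: "linear A"
  let ?N = "max (degree p) (degree q)"
  have "degree (p + q) \<le> ?N" by (rule degree_add_le_max)
  then show ?thesis
    by (simp add: poly_op_eq_sum[of _ ?N] sum.distrib scaleR_add_left)
qed

lemma poly_op_smult: "linear A \<Longrightarrow> poly_op (smult c p) A x = c *\<^sub>R poly_op p A x"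
  by (simp add: poly_op_eq_sum[of "smult c p" "degree p"] poly_op_def scaleR_sum_right)

lemma poly_op_0 [simp]: "poly_op 0 A x = 0" by (simp add: poly_op_def)

lemma poly_op_const: "poly_op [:c:] A x = c *\<^sub>R x"
  by (simp add: poly_op_def)

lemma poly_op_shift:
  assumes A: "linear A" shows "poly_op (pCons 0 p) A x = poly_op p A (A x)"
proof -
  have "degree (pCons 0 p) \<le> Suc (degree p)" by (simp add: degree_pCons_le)
  then have "poly_op (pCons 0 p) A x = (\<Sum>i\<le>Suc (degree p). coeff (pCons 0 p) i *\<^sub>R (A ^^ i) x)"
    by (rule poly_op_eq_sum)
  also have "\<dots> = (\<Sum>i\<le>degree p. coeff p i *\<^sub>R (A ^^ Suc i) x)"
    by (subst sum.atMost_Suc_shift) (simp add: coeff_pCons)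
  finally show ?thesis by (simp add: poly_op_def funpow_Suc_right del: funpow.simps)
qed

lemma poly_op_pCons:
  assumes A: "linear A" shows "poly_op (pCons a p) A x = a *\<^sub>R x + poly_op p A (A x)"
proof -
  have "pCons a p = [:a:] + pCons 0 p" by simp
  then show ?thesis by (simp only: poly_op_add[OF A] poly_op_shift[OF A] poly_op_const)
qed

lemma poly_op_linear: assumes "linear A" shows "linear (poly_op p A)"
  unfolding poly_op_def
  by (intro linear_compose_sum ballI linear_compose_scale_right linear_funpow assms)

lemma poly_op_commute:
  assumes A: "linear A" shows "A (poly_op p A x) = poly_op p A (A x)"
proof -
  have "A ((A ^^ i) x) = (A ^^ i) (A x)" for i by (rule funpow_swap1)
  then show ?thesis unfolding poly_op_def by (simp only: linear_sum[OF A] linear_cmul[OF A])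
qed

lemma poly_op_mult:
  assumes A: "linear A" shows "poly_op (p * q) A x = poly_op p A (poly_op q A x)"
proof (induction p arbitrary: x)
  case 0 then show ?case by simp
next
  case (pCons a p)
  show ?case
    using pCons by (simp add: mult_pCons_left poly_op_add[OF A] poly_op_smult[OF A] poly_op_shift[OF A]
      poly_op_pCons[OF A] poly_op_commute[OF A])
qed

lemma poly_op_prod_annihilates:
  assumes A: "linear A" and "finite I" "i \<in> I" "poly_op (f i) A x = 0"
  shows "poly_op (prod f I) A x = 0"
proof -
  have "prod f I = prod f (I - {i}) * f i"
    using assms by (simp add: prod.remove mult.commute)
  then show ?thesis using assms linear_0[OF poly_op_linear[OF A]] by (simp add: poly_op_mult[OF A])
qed

text \<open>The vectors \<open>A x, A\<^sup>2 x, \<dots>\<close> lie in a space of dimension at most \<open>card B\<close>, so \<open>card B + 1\<close> of them are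
linearly dependent, or two of them coincide.\<close>

lemma finite_span_annihilating_poly_vector:
  fixes A :: "'a::real_vector \<Rightarrow> 'a"
  assumes "finite B" and range: "\<And>x. A x \<in> span B"
  obtains p where "p \<noteq> 0" "poly_op p A x = 0"
proof (cases "inj_on (\<lambda>j. (A ^^ j) x) {1..Suc (card B)}")
  case True
  let ?W = "(\<lambda>j. (A ^^ j) x) ` {1..Suc (card B)}"
  have sub: "?W \<subseteq> span B"
  proof (clarify)
    fix j assume "j \<in> {1..Suc (card B)}"
    then obtain i where "j = Suc i" by (cases j) auto
    then show "(A ^^ j) x \<in> span B" using range by simp
  qed
  have "card ?W = Suc (card B)" using True by (simp add: card_image)
  then have "dependent ?W"
    using independent_span_bound[OF assms(1) _ sub] by auto
  then obtain u w where u: "(\<Sum>w\<in>?W. u w *\<^sub>R w) = 0" "w \<in> ?W" "u w \<noteq> 0"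
    by (subst (asm) dependent_finite) auto
  define c where "c j = (if j \<in> {1..Suc (card B)} then u ((A ^^ j) x) else 0)" for j
  define p where "p = (\<Sum>j\<le>Suc (card B). monom (c j) j)"
  have cp: "coeff p j = c j" for j
    by (auto simp: p_def coeff_sum c_def)
  have deg: "degree p \<le> Suc (card B)"
    by (rule degree_le) (auto simp: cp c_def)
  have "(\<Sum>i\<le>Suc (card B). c i *\<^sub>R (A ^^ i) x) = (\<Sum>i\<in>{1..Suc (card B)}. u ((A ^^ i) x) *\<^sub>R (A ^^ i) x)"
    by (rule sum.mono_neutral_cong_right) (auto simp: c_def)
  also have "\<dots> = 0" using u(1) True by (simp add: sum.reindex del: funpow.simps)
  finally have 0: "(\<Sum>i\<le>Suc (card B). c i *\<^sub>R (A ^^ i) x) = 0" .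
  have "poly_op p A x = (\<Sum>i\<le>Suc (card B). c i *\<^sub>R (A ^^ i) x)"
    unfolding poly_op_eq_sum[OF deg] by (simp only: cp)
  moreover have "p \<noteq> 0"
  proof -
    obtain j where "j \<in> {1..Suc (card B)}" "w = (A ^^ j) x" using u(2) by auto
    then have "coeff p j \<noteq> 0" using u(3) by (simp add: cp c_def)
    then show ?thesis by auto
  qed
  ultimately show ?thesis using that 0 by auto
next
  case False
  then obtain i j where ij: "i \<noteq> j" "(A ^^ i) x = (A ^^ j) x" by (auto simp: inj_on_def)
  define p where "p = monom (1::real) i - monom 1 j"
  have cp: "coeff p l = (if l = i then 1 else 0) - (if l = j then 1 else 0)" for l
    by (simp add: p_def)
  have deg: "degree p \<le> max i j" by (rule degree_le) (auto simp: cp)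
  have "poly_op p A x = (\<Sum>l\<le>max i j. coeff p l *\<^sub>R (A ^^ l) x)"
    by (rule poly_op_eq_sum[OF deg])
  also have "\<dots> = (\<Sum>l\<le>max i j. (if l = i then (A ^^ l) x else 0) - (if l = j then (A ^^ l) x else 0))"
    unfolding cp by (intro sum.cong refl) (simp add: scaleR_diff_left)
  also have "\<dots> = (A ^^ i) x - (A ^^ j) x"
    by (simp only: sum_subtractf sum.delta finite_atMost) simp
  also have "\<dots> = 0" using ij(2) by simp
  finally have "poly_op p A x = 0" .
  moreover have "coeff p i \<noteq> 0" using ij(1) by (simp add: cp)
  then have "p \<noteq> 0" by auto
  ultimately show ?thesis using that by blast
qed

text \<open>The product of the annihilating polynomials of the spanning vectors kills the range of \<open>A\<close>; one
further factor \<open>t\<close> makes it kill the whole space.\<close>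

lemma finite_span_annihilating_poly:
  fixes A :: "'a::real_vector \<Rightarrow> 'a"
  assumes A: "linear A" and B: "finite B" and range: "\<And>x. A x \<in> span B"
  obtains p where "p \<noteq> 0" "\<And>x. poly_op p A x = 0"
proof -
  have "\<exists>p. p \<noteq> 0 \<and> poly_op p A b = 0" for b
    using finite_span_annihilating_poly_vector[of B A b thesis for thesis, OF B range] by blast
  then obtain f where f: "\<And>b. f b \<noteq> 0" "\<And>b. poly_op (f b) A b = 0" by metis
  define p where "p = prod f B"
  have "poly_op p A b = 0" if "b \<in> B" for b
    unfolding p_def by (rule poly_op_prod_annihilates[OF A B that]) (rule f(2))
  then have "poly_op p A (A x) = 0" for x
    using range[of x] linear_eq_0_on_span[OF poly_op_linear[OF A]] by blast
  then have "poly_op (pCons 0 p) A x = 0" for x by (simp add: poly_op_shift[OF A])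
  moreover have "pCons 0 p \<noteq> 0" using f(1) B by (simp add: p_def)
  ultimately show ?thesis using that by blast
qed

lemma map_poly_of_real_add:
  "map_poly complex_of_real (p + q) = map_poly complex_of_real p + map_poly complex_of_real q"
  by (rule poly_eqI) (simp add: coeff_map_poly)

lemma map_poly_of_real_mult:
  "map_poly complex_of_real (p * q) = map_poly complex_of_real p * map_poly complex_of_real q"
  by (rule poly_eqI) (simp add: coeff_map_poly coeff_mult)

lemma poly_map_poly_of_real:
  "poly (map_poly complex_of_real p) (complex_of_real x) = complex_of_real (poly p x)"
  by (induction p) (simp_all add: map_poly_pCons)

text \<open>An annihilating polynomial may be shortened until it has only simple real roots.  A pair of
non-real roots gives the factor \<open>(t - a)\<^sup>2 + b\<^sup>2\<close>, which is injective at a self-adjoint \<open>A\<close>; a real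
root \<open>c\<close> is split off by inverting \<open>A - c\<close> on the eigenvectors for the other roots; it need not be
taken twice, since an eigenvector for \<open>c\<close> in the image of \<open>A - c\<close> is orthogonal to itself.\<close>

lemma selfadjoint_eigen_decomposition:
  fixes A :: "'a::real_inner \<Rightarrow> 'a"
  assumes A: "linear A" and sa: "\<And>x y. A x \<bullet> y = x \<bullet> A y"
  shows "p \<noteq> 0 \<Longrightarrow> poly_op p A x = 0 \<Longrightarrow>
    \<exists>y. x = (\<Sum>c | poly p c = 0. y c) \<and> (\<forall>c. poly p c = 0 \<longrightarrow> A (y c) = c *\<^sub>R y c)"
proof (induction "degree p" arbitrary: p x rule: less_induct)
  case less
  show ?case
  proof (cases "degree p = 0")
    case True
    then obtain c where "p = [:c:]" by (rule degree_eq_zeroE)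
    then show ?thesis using less.prems by (auto simp: poly_op_const)
  next
    case False
    have "\<not> constant (poly (map_poly complex_of_real p))"
      using False by (simp add: constant_degree degree_map_poly)
    then obtain z where z: "poly (map_poly complex_of_real p) z = 0"
      using fundamental_theorem_of_algebra by blast
    show ?thesis
    proof (cases "Im z = 0")
      case True
      define c where "c = Re z"
      have "z = complex_of_real c" using True by (simp add: c_def complex_eq_iff)
      then have pc: "poly p c = 0" using z by (simp add: poly_map_poly_of_real)
      then obtain p' where p': "p = [:-c, 1:] * p'" by (auto simp: poly_eq_0_iff_dvd dvd_def)
      have p'0: "p' \<noteq> 0" using less.prems p' by auto
      have deg: "degree p' < degree p" using p'0 unfolding p' by (subst degree_mult_eq) auto
      define z where "z = A x - c *\<^sub>R x"
      have "poly_op p' A z = poly_op (p' * [:-c, 1:]) A x"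
        unfolding poly_op_mult[OF A] by (simp add: poly_op_pCons[OF A] z_def)
      also have "\<dots> = 0" using less.prems p' by (simp add: mult.commute)
      finally obtain w where w: "z = (\<Sum>c | poly p' c = 0. w c)"
        "\<And>c. poly p' c = 0 \<Longrightarrow> A (w c) = c *\<^sub>R w c"
        using less.hyps[OF deg p'0] by blast
      define w' where "w' d = (if poly p' d = 0 then w d else 0)" for d
      have w': "A (w' d) = d *\<^sub>R w' d" for d
        using w(2) by (auto simp: w'_def linear_0[OF A])
      have fin: "finite {d. poly p d = 0}" using poly_roots_finite[OF less.prems(1)] .
      have "z = (\<Sum>d | poly p d = 0. w' d)"
        unfolding w(1) by (rule sum.mono_neutral_cong_left) (use fin p' in \<open>auto simp: w'_def\<close>)
      then have z': "z = w' c + (\<Sum>d\<in>{d. poly p d = 0} - {c}. w' d)"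
        using fin pc by (simp add: sum.remove)
      define x' where "x' = x - (\<Sum>d\<in>{d. poly p d = 0} - {c}. (1/(d-c)) *\<^sub>R w' d)"
      have x'1: "A x' - c *\<^sub>R x' = w' c"
      proof -
        have "A x' - c *\<^sub>R x' = z - (\<Sum>d\<in>{d. poly p d = 0} - {c}. (1/(d-c)) *\<^sub>R (A (w' d) - c *\<^sub>R w' d))"
          by (simp add: x'_def z_def linear_diff[OF A] linear_sum[OF A] linear_cmul[OF A]
             scaleR_sum_right scaleR_diff_right sum_subtractf mult.commute)
        also have "(\<Sum>d\<in>{d. poly p d = 0} - {c}. (1/(d-c)) *\<^sub>R (A (w' d) - c *\<^sub>R w' d))
           = (\<Sum>d\<in>{d. poly p d = 0} - {c}. w' d)"
          by (rule sum.cong) (auto simp: w' scaleR_diff_left[symmetric])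
        finally show ?thesis using z' by simp
      qed
      have "w' c \<bullet> w' c = (A x' - c *\<^sub>R x') \<bullet> w' c" by (simp add: x'1)
      also have "\<dots> = x' \<bullet> (A (w' c) - c *\<^sub>R w' c)"
        by (simp add: inner_diff_left inner_diff_right sa)
      also have "\<dots> = 0" by (simp add: w')
      finally have "A x' = c *\<^sub>R x'" using x'1 by simp
      then show ?thesis
      proof (intro exI[of _ "\<lambda>d. if d = c then x' else (1/(d-c)) *\<^sub>R w' d"] conjI allI impI)
        show "x = (\<Sum>d | poly p d = 0. if d = c then x' else (1/(d-c)) *\<^sub>R w' d)"
          using fin pc by (simp add: sum.remove[where x = c] x'_def)
      qed (auto simp: w' linear_cmul[OF A])
    next
      case False
      define a b where "a = Re z" and "b = Im z"
      define qd where "qd = [:a\<^sup>2 + b\<^sup>2, - 2 * a, 1:]"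
      have q0: "poly (map_poly complex_of_real qd) z = 0"
        by (simp add: qd_def a_def b_def map_poly_pCons complex_eq_iff power2_eq_square algebra_simps)
      have qdeg: "degree qd = 2" by (simp add: qd_def)
      have "qd dvd p"
      proof -
        have "poly (map_poly complex_of_real (p mod qd)) z = 0"
        proof -
          have "map_poly complex_of_real (p div qd * qd + p mod qd) = map_poly complex_of_real p" by simp
          then have "poly (map_poly complex_of_real (p div qd)) z * poly (map_poly complex_of_real qd) z
            + poly (map_poly complex_of_real (p mod qd)) z = 0"
            unfolding map_poly_of_real_add map_poly_of_real_mult using z by (metis poly_add poly_mult)
          then show ?thesis using q0 by simp
        qed
        moreover obtain u w where uw: "p mod qd = [:u, w:]"
        proof -
          have "degree (p mod qd) < 2"
            using degree_mod_less[of qd p] qdeg by (auto simp: qd_def)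
          then have "p mod qd = [:coeff (p mod qd) 0, coeff (p mod qd) 1:]"
            by (intro poly_eqI) (auto simp: coeff_pCons coeff_eq_0 split: nat.splits)
          then show ?thesis by (rule that)
        qed
        ultimately have "w * b = 0" "u + w * a = 0"
          by (auto simp: a_def b_def map_poly_pCons complex_eq_iff mult.commute)
        then have "p mod qd = 0" using False uw by (simp add: b_def)
        then show ?thesis by (simp add: dvd_eq_mod_eq_0)
      qed
      then obtain p' where p': "p = qd * p'" by (auto simp: dvd_def)
      have p'0: "p' \<noteq> 0" using less.prems p' by auto
      have deg: "degree p' < degree p" using p'0 unfolding p' by (subst degree_mult_eq) (use qdeg in auto)
      have rts: "poly p c = 0 \<longleftrightarrow> poly p' c = 0" for c
      proof -
        have "poly qd c = (c - a)\<^sup>2 + b\<^sup>2" by (simp add: qd_def power2_eq_square algebra_simps)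
        then have "poly qd c > 0" using False by (simp add: b_def add_nonneg_pos)
        then show ?thesis by (simp add: p')
      qed
      define y where "y = poly_op p' A x"
      have "poly_op qd A y = 0" using less.prems(2) by (simp add: p' y_def poly_op_mult[OF A])
      then have "0 = poly_op qd A y \<bullet> y" by simp
      also have "\<dots> = (A y - a *\<^sub>R y) \<bullet> (A y - a *\<^sub>R y) + b\<^sup>2 * (y \<bullet> y)"
        by (simp add: qd_def poly_op_pCons[OF A] poly_op_const linear_cmul[OF A] sa inner_simps
            inner_commute power2_eq_square algebra_simps)
      finally have "b\<^sup>2 * (y \<bullet> y) = 0"
        by (metis add_nonneg_eq_0_iff inner_ge_zero mult_nonneg_nonneg zero_le_power2)
      then have "y = 0" using False by (simp add: b_def)
      then show ?thesis using less.hyps[OF deg p'0] by (simp add: y_def rts)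
    qed
  qed
qed

section \<open>Functional calculus of a finite resolution of the identity\<close>

text \<open>Spectral projections \<open>E c\<close> for the finitely many \<open>c \<in> S\<close>.  Some \<open>E c\<close> may vanish, so \<open>S\<close> is only
required to contain the spectrum.\<close>

locale spectral_resolution =
  fixes A :: "'a::real_inner \<Rightarrow> 'a" and S :: "real set" and E :: "real \<Rightarrow> 'a \<Rightarrow> 'a"
  assumes linear_A: "linear A"
    and selfadjoint: "\<And>x y. A x \<bullet> y = x \<bullet> A y"
    and finite_S: "finite S"
    and S_nonneg: "\<And>c. c \<in> S \<Longrightarrow> 0 \<le> c"
    and sum_E: "\<And>x. (\<Sum>c\<in>S. E c x) = x"
    and A_E: "\<And>c x. c \<in> S \<Longrightarrow> A (E c x) = c *\<^sub>R E c x"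
begin

lemma eigvec_orthogonal:
  assumes "A y = c *\<^sub>R y" "A z = d *\<^sub>R z" "c \<noteq> d"
  shows "y \<bullet> z = 0"
proof -
  have "c * (y \<bullet> z) = d * (y \<bullet> z)" using selfadjoint[of y z] assms by simp
  then show ?thesis using assms(3) by simp
qed

text \<open>Eigenvectors for different eigenvalues are orthogonal, so the decomposition of a vector into
eigenvectors is unique.  Linearity of \<open>E c\<close> and all rules of the functional calculus come from this.\<close>

lemma E_unique:
  assumes "(\<Sum>c\<in>S. y c) = x" "\<And>c. c \<in> S \<Longrightarrow> A (y c) = c *\<^sub>R y c" "c \<in> S"
  shows "E c x = y c"
proof -
  define w where "w d = E d x - y d" for d
  have w: "A (w d) = d *\<^sub>R w d" if "d \<in> S" for d
    using that assms(2) A_E by (simp add: w_def linear_diff[OF linear_A] scaleR_diff_right)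
  have "0 = (\<Sum>d\<in>S. w d) \<bullet> w c" by (simp add: w_def sum_subtractf sum_E assms(1))
  also have "\<dots> = (\<Sum>d\<in>S. if d = c then w c \<bullet> w c else 0)"
    unfolding inner_sum_left using assms(3) by (intro sum.cong refl) (auto intro: eigvec_orthogonal w)
  also have "\<dots> = w c \<bullet> w c" using assms(3) finite_S by simp
  finally show ?thesis by (simp add: w_def)
qed

lemma linear_E: assumes "c \<in> S" shows "linear (E c)"
proof (rule linearI)
  show "E c (x + y) = E c x + E c y" for x y
    by (rule E_unique[where y = "\<lambda>c. E c x + E c y"])
       (simp_all add: sum.distrib sum_E linear_add[OF linear_A] A_E scaleR_add_right assms)
  show "E c (a *\<^sub>R x) = a *\<^sub>R E c x" for a x
    by (rule E_unique[where y = "\<lambda>c. a *\<^sub>R E c x"])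
       (simp_all add: scaleR_sum_right[symmetric] sum_E linear_cmul[OF linear_A] A_E assms)
qed

definition fcalc :: "(real \<Rightarrow> real) \<Rightarrow> 'a \<Rightarrow> 'a" where
  "fcalc f x = (\<Sum>c\<in>S. f c *\<^sub>R E c x)"

lemma linear_fcalc: "linear (fcalc f)"
  unfolding fcalc_def by (intro linear_compose_sum ballI linear_compose_scale_right linear_E)

lemma E_fcalc: assumes "c \<in> S" shows "E c (fcalc f x) = f c *\<^sub>R E c x"
  by (rule E_unique[where y = "\<lambda>c. f c *\<^sub>R E c x"])
     (simp_all add: fcalc_def linear_cmul[OF linear_A] A_E assms)

lemma fcalc_fcalc: "fcalc f (fcalc g x) = fcalc (\<lambda>c. f c * g c) x"
  unfolding fcalc_def[of f] fcalc_def[of "\<lambda>c. f c * g c"] by (intro sum.cong refl) (simp add: E_fcalc)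

lemma fcalc_cong: "(\<And>c. c \<in> S \<Longrightarrow> f c = g c) \<Longrightarrow> fcalc f x = fcalc g x"
  by (simp add: fcalc_def)

lemma fcalc_1: "fcalc (\<lambda>_. 1) x = x" by (simp add: fcalc_def sum_E)

lemma fcalc_add: "fcalc (\<lambda>c. f c + g c) x = fcalc f x + fcalc g x"
  by (simp add: fcalc_def scaleR_add_left sum.distrib)

lemma fcalc_scale: "fcalc (\<lambda>c. a * f c) x = a *\<^sub>R fcalc f x"
  by (simp add: fcalc_def scaleR_sum_right)

lemma A_eq_fcalc: "A x = fcalc (\<lambda>c. c) x"
proof -
  have "A x = A (\<Sum>c\<in>S. E c x)" by (simp add: sum_E)
  then show ?thesis by (simp add: linear_sum[OF linear_A] A_E fcalc_def)
qed

lemma funpow_eq_fcalc: "(A ^^ k) x = fcalc (\<lambda>c. c ^ k) x"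
  by (induction k) (simp_all add: fcalc_1 A_eq_fcalc fcalc_fcalc)

lemma poly_op_eq_fcalc: "poly_op p A x = fcalc (poly p) x"
  unfolding poly_op_def funpow_eq_fcalc
  by (simp add: fcalc_def poly_altdef scaleR_sum_right scaleR_sum_left sum.swap[of _ S])

lemma inner_fcalc: "fcalc f x \<bullet> fcalc g x = (\<Sum>c\<in>S. f c * g c * (norm (E c x))\<^sup>2)"
proof -
  have "fcalc f x \<bullet> fcalc g x = (\<Sum>c\<in>S. \<Sum>d\<in>S. if d = c then f c * g c * (norm (E c x))\<^sup>2 else 0)"
    unfolding fcalc_def inner_sum_left inner_sum_right
    by (intro sum.cong refl) (auto simp: power2_norm_eq_inner eigvec_orthogonal[OF A_E A_E])
  then show ?thesis using finite_S by (simp cong: sum.cong)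
qed

lemma norm_fcalc: "(norm (fcalc f x))\<^sup>2 = (\<Sum>c\<in>S. (f c)\<^sup>2 * (norm (E c x))\<^sup>2)"
  unfolding power2_norm_eq_inner[of "fcalc f x"] inner_fcalc by (simp add: power2_eq_square)

lemma norm_fcalc_mono:
  assumes "\<And>c. c \<in> S \<Longrightarrow> \<bar>f c\<bar> \<le> \<bar>g c\<bar>"
  shows "norm (fcalc f x) \<le> norm (fcalc g x)"
proof -
  have "(norm (fcalc f x))\<^sup>2 \<le> (norm (fcalc g x))\<^sup>2"
    unfolding norm_fcalc by (intro sum_mono mult_right_mono) (use assms in \<open>auto simp: abs_le_square_iff\<close>)
  then show ?thesis by (rule power2_le_imp_le) simp
qed

lemma norm_fcalc_le:
  assumes "\<And>c. c \<in> S \<Longrightarrow> \<bar>f c\<bar> \<le> b" "0 \<le> b"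
  shows "norm (fcalc f x) \<le> b * norm x"
proof -
  have "norm (fcalc f x) \<le> norm (fcalc (\<lambda>_. b * 1) x)"
    by (rule norm_fcalc_mono) (use assms in auto)
  also have "\<dots> = b * norm x" unfolding fcalc_scale using assms(2) by (simp add: fcalc_1)
  finally show ?thesis .
qed

end

theorem finite_rank_spectral_resolution:
  fixes A :: "'a::real_inner \<Rightarrow> 'a"
  assumes A: "linear A" and sa: "\<And>x y. A x \<bullet> y = x \<bullet> A y" and pos: "\<And>x. 0 \<le> A x \<bullet> x"
    and B: "finite B" "\<And>x. A x \<in> span B"
  obtains S E where "spectral_resolution A S E"
proof -
  obtain p where p: "p \<noteq> 0" "\<And>x. poly_op p A x = 0"
    using finite_span_annihilating_poly[OF A B] by blast
  obtain y where y: "\<And>x. x = (\<Sum>c | poly p c = 0. y x c)"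
      "\<And>x c. poly p c = 0 \<Longrightarrow> A (y x c) = c *\<^sub>R y x c"
    using selfadjoint_eigen_decomposition[OF A sa p(1) p(2)] by metis
  \<comment> \<open>Negative roots of \<open>p\<close> carry no eigenvectors and are dropped.\<close>
  define S where "S = {c. poly p c = 0 \<and> 0 \<le> c}"
  have fin: "finite {c. poly p c = 0}" by (rule poly_roots_finite[OF p(1)])
  have neg: "y x c = 0" if "poly p c = 0" "c < 0" for x c
  proof -
    have "0 \<le> c * (y x c \<bullet> y x c)" using pos[of "y x c"] y(2)[OF that(1)] by simp
    then show ?thesis using that(2) by (metis inner_ge_zero inner_eq_zero_iff mult_less_0_iff not_less order_le_less)
  qed
  have "spectral_resolution A S (\<lambda>c x. y x c)"
  proof (rule spectral_resolution.intro)
    show "finite S" by (rule finite_subset[OF _ fin]) (auto simp: S_def)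
    fix x
    have "(\<Sum>c\<in>S. y x c) = (\<Sum>c | poly p c = 0. y x c)"
      by (rule sum.mono_neutral_left) (use fin neg in \<open>auto simp: S_def not_le\<close>)
    then show "(\<Sum>c\<in>S. y x c) = x" using y(1) by simp
  qed (use A sa y(2) in \<open>auto simp: S_def\<close>)
  then show ?thesis by (rule that)
qed

section \<open>The residual polynomial and the minimal residual\<close>

lemma power_mult_exp_neg_half_le:
  fixes t :: real
  assumes "0 \<le> t" "0 < N"
  shows "t ^ N * exp (- t / 2) \<le> (2 * real N) ^ N"
proof -
  have "(t / (2 * real N)) ^ N \<le> (1 + (t / 2) / real N) ^ N"
    by (rule power_mono) (use assms in auto)
  also have "\<dots> \<le> exp (t / 2)"
    by (rule exp_ge_one_plus_x_over_n_power_n) (use assms in auto)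
  finally have "t ^ N / (2 * real N) ^ N \<le> exp (t / 2)"
    by (simp only: power_divide)
  then have "t ^ N \<le> exp (t / 2) * (2 * real N) ^ N"
    by (subst (asm) pos_divide_le_eq) (use assms in auto)
  then have "t ^ N * exp (- (t / 2)) \<le> exp (t / 2) * (2 * real N) ^ N * exp (- (t / 2))"
    by (rule mult_right_mono) simp
  also have "\<dots> = (2 * real N) ^ N" by (simp add: exp_minus)
  finally show ?thesis by simp
qed

lemma one_minus_prod_le_sum:
  fixes x :: "'i \<Rightarrow> real"
  assumes "finite I" "\<And>i. i \<in> I \<Longrightarrow> 0 \<le> x i \<and> x i \<le> 1"
  shows "1 - (\<Prod>i\<in>I. 1 - x i) \<le> (\<Sum>i\<in>I. x i)"
  using assms
proof (induction I rule: finite_induct)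
  case (insert a I)
  have "(\<Prod>i\<in>I. 1 - x i) \<le> 1" by (rule prod_le_1) (use insert in auto)
  then have "x a * (\<Prod>i\<in>I. 1 - x i) \<le> x a * 1"
    using insert by (intro mult_left_mono) auto
  then show ?case using insert by (simp add: algebra_simps)
qed simp

text \<open>The residual polynomial is determined by its roots \<open>Z\<close>, because its value at 0 is 1.  Everything that
the error analysis needs is a property of such a product and of \<open>inv_sum\<close>, which is \<open>|Q'(0)|\<close>.\<close>

locale positive_roots =
  fixes Z :: "real set"
  assumes finite_Z: "finite Z" and Z_nonempty: "Z \<noteq> {}" and Z_pos: "\<And>t. t \<in> Z \<Longrightarrow> 0 < t"
begin

definition root_prod :: "real \<Rightarrow> real" where "root_prod x = (\<Prod>t\<in>Z. 1 - x / t)"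
definition inv_sum :: real where "inv_sum = (\<Sum>t\<in>Z. 1 / t)"
definition min_root :: real where "min_root = Min Z"
definition cofactor :: "real \<Rightarrow> real" where
  "cofactor x = (\<Prod>t\<in>Z - {min_root}. 1 - x / t)"

text \<open>The weight in the bound of the residual norm.  Of the factor \<open>1 - x / min_root\<close> of the
residual polynomial it keeps the square root.\<close>

definition damped :: "real \<Rightarrow> real" where
  "damped x = (if x < min_root then root_prod x * sqrt (min_root / (min_root - x)) else 0)"

lemma min_root_mem: "min_root \<in> Z" and min_root_le: "t \<in> Z \<Longrightarrow> min_root \<le> t"
  using finite_Z Z_nonempty by (auto simp: min_root_def)

lemma min_root_pos: "0 < min_root" using Z_pos min_root_mem .

lemma root_prod_eq_cofactor: "root_prod x = (1 - x / min_root) * cofactor x"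
  unfolding root_prod_def cofactor_def using finite_Z min_root_mem by (rule prod.remove)

lemma inv_sum_eq: "inv_sum = 1 / min_root + (\<Sum>t\<in>Z - {min_root}. 1 / t)"
  unfolding inv_sum_def using finite_Z min_root_mem by (rule sum.remove)

lemma inverse_min_root_le: "1 / min_root \<le> inv_sum"
  unfolding inv_sum_eq using Z_pos by (auto intro!: sum_nonneg simp: less_imp_le)

lemma inv_sum_pos: "0 < inv_sum"
  using inverse_min_root_le min_root_pos by (smt (verit) divide_pos_pos)

lemma inverse_inv_sum_le: "1 / inv_sum \<le> min_root"
  using inverse_min_root_le min_root_pos inv_sum_pos by (simp add: field_simps)

lemma factor_bounds:
  assumes "t \<in> Z" "0 \<le> x" "x \<le> min_root"
  shows "0 \<le> x / t" "x / t \<le> 1"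
  using assms Z_pos[of t] min_root_le[of t] by auto

lemma root_prod_bounds:
  assumes "0 \<le> x" "x \<le> min_root"
  shows "0 \<le> root_prod x" "root_prod x \<le> 1" "1 - root_prod x \<le> inv_sum * x"
proof -
  show "0 \<le> root_prod x" unfolding root_prod_def
    by (rule prod_nonneg) (use factor_bounds[OF _ assms] in auto)
  show "root_prod x \<le> 1" unfolding root_prod_def
    by (rule prod_le_1) (use factor_bounds[OF _ assms] in auto)
  have "1 - root_prod x \<le> (\<Sum>t\<in>Z. x / t)" unfolding root_prod_def
    by (rule one_minus_prod_le_sum[OF finite_Z]) (use factor_bounds[OF _ assms] in auto)
  then show "1 - root_prod x \<le> inv_sum * x" by (simp add: inv_sum_def sum_distrib_right)
qed

lemma damped_square:
  assumes "0 \<le> x" "x < min_root"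
  shows "(damped x)\<^sup>2 = (1 - x / min_root) * (cofactor x)\<^sup>2"
proof -
  have "(damped x)\<^sup>2 = (1 - x / min_root)\<^sup>2 * (cofactor x)\<^sup>2 * (min_root / (min_root - x))"
    using assms min_root_pos by (simp add: damped_def root_prod_eq_cofactor power_mult_distrib)
  also have "min_root / (min_root - x) = 1 / (1 - x / min_root)"
    using assms min_root_pos by (simp add: field_simps)
  finally show ?thesis using assms min_root_pos by (simp add: power2_eq_square)
qed

text \<open>The square of \<open>damped\<close> is a product of factors \<open>1 - x / t \<le> exp (- x / t)\<close> in which every root but the
smallest occurs twice, hence at most \<open>exp (- inv_sum * x)\<close>.\<close>

lemma damped_bound:
  assumes "0 \<le> x" shows "\<bar>damped x\<bar> \<le> exp (- (inv_sum * x) / 2)"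
proof (cases "x < min_root")
  case True
  have e: "0 \<le> 1 - x / t \<and> 1 - x / t \<le> exp (- x / t)" if "t \<in> Z" for t
    using factor_bounds[OF that assms] True exp_ge_add_one_self[of "- x / t"] by auto
  have "cofactor x \<le> (\<Prod>t\<in>Z - {min_root}. exp (- x / t))" unfolding cofactor_def
    by (rule prod_mono) (use e in auto)
  also have "\<dots> = exp (\<Sum>t\<in>Z - {min_root}. - x / t)" by (rule exp_sum[symmetric]) (use finite_Z in auto)
  finally have c: "cofactor x \<le> exp (- x * (\<Sum>t\<in>Z - {min_root}. 1 / t))" by (simp add: sum_distrib_left sum_negf)
  have c0: "0 \<le> cofactor x" unfolding cofactor_def by (rule prod_nonneg) (use e in auto)
  define s where "s = (\<Sum>t\<in>Z - {min_root}. 1 / t)"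
  have s0: "0 \<le> s" unfolding s_def using Z_pos by (auto intro!: sum_nonneg simp: less_imp_le)
  have "(damped x)\<^sup>2 = (1 - x / min_root) * (cofactor x)\<^sup>2" by (rule damped_square[OF assms True])
  also have "\<dots> \<le> exp (- x / min_root) * (exp (- x * s))\<^sup>2"
    using e[OF min_root_mem] c c0 by (intro mult_mono power_mono) (auto simp: s_def)
  also have "\<dots> = exp (- x / min_root - 2 * (x * s))"
    by (simp add: exp_double[symmetric] exp_add[symmetric] mult.assoc del: exp_double)
  also have "\<dots> \<le> exp (- (inv_sum * x))"
    using assms s0 by (simp add: inv_sum_eq s_def[symmetric] algebra_simps)
  also have "\<dots> = (exp (- (inv_sum * x) / 2))\<^sup>2" by (simp add: exp_double[symmetric])
  finally show ?thesis by (simp add: abs_le_square_iff[symmetric])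
next
  case False
  then show ?thesis by (simp add: damped_def)
qed

text \<open>Multiplying the damped weight by \<open>x\<^sup>j\<close> gains \<open>inv_sum^(-j)\<close> for every \<open>j\<close>.  In this sense the minimal
residual method has no saturation.\<close>

lemma power_damped_bound:
  assumes "0 \<le> x"
  shows "\<bar>x ^ j * (inv_sum * x * damped x)\<bar> \<le> (2 * real (Suc j)) ^ Suc j * (1 / inv_sum) ^ j"
proof -
  have "\<bar>x ^ j * (inv_sum * x * damped x)\<bar> = (inv_sum * x) ^ Suc j * (1 / inv_sum) ^ j * \<bar>damped x\<bar>"
    using assms inv_sum_pos by (simp add: abs_mult power_mult_distrib power_divide)
  also have "\<dots> \<le> (inv_sum * x) ^ Suc j * (1 / inv_sum) ^ j * exp (- (inv_sum * x) / 2)"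
    using assms inv_sum_pos by (intro mult_left_mono damped_bound) auto
  also have "\<dots> = (inv_sum * x) ^ Suc j * exp (- (inv_sum * x) / 2) * (1 / inv_sum) ^ j" by (simp only: mult_ac)
  also have "\<dots> \<le> (2 * real (Suc j)) ^ Suc j * (1 / inv_sum) ^ j"
    using assms inv_sum_pos by (intro mult_right_mono power_mult_exp_neg_half_le) auto
  finally show ?thesis .
qed

end

text \<open>Both sides have degree at most the number of roots, and they agree at 0 and at the roots, which is one
point more.\<close>

lemma poly_eq_prod_roots:
  fixes Q :: "real poly"
  assumes deg: "degree Q \<le> card {t. poly Q t = 0}" and Q0: "poly Q 0 = 1"
  shows "Q = (\<Prod>t | poly Q t = 0. [:1, - 1 / t:])"
proof -
  let ?Z = "{t. poly Q t = 0}"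
  have "Q \<noteq> 0" using Q0 by auto
  then have fin: "finite ?Z" by (rule poly_roots_finite)
  have degP: "degree (\<Prod>t\<in>?Z. [:1, - 1 / t:]) \<le> card ?Z"
  proof -
    have "sum (degree \<circ> (\<lambda>t. [:1, - 1 / t:])) ?Z \<le> of_nat (card ?Z) * 1"
      by (rule sum_bounded_above) (simp add: degree_pCons_le)
    then show ?thesis using degree_prod_sum_le[OF fin, of "\<lambda>t. [:1, - 1 / t:]"] by simp
  qed
  have card: "card (insert 0 ?Z) = Suc (card ?Z)" using fin Q0 by simp
  show ?thesis
  proof (rule poly_eqI_degree)
    fix x assume "x \<in> insert 0 ?Z"
    then consider "x = 0" | "x \<in> ?Z" "x \<noteq> 0" using Q0 by auto
    then show "poly Q x = poly (\<Prod>t\<in>?Z. [:1, - 1 / t:]) x"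
    proof cases
      case 1 then show ?thesis using Q0 by (simp add: poly_prod)
    next
      case 2
      then have "\<exists>t\<in>?Z. poly [:1, - 1 / t:] x = 0" by (intro bexI[of _ x]) auto
      then show ?thesis using 2 fin by (simp add: poly_prod prod_zero_iff del: poly_pCons)
    qed
  qed (use deg degP card in auto)
qed

lemma residual_poly_factors:
  assumes "is_residual_poly A r m Q" and card: "card {t. poly Q t = 0} = m"
  shows "Q = (\<Prod>t | poly Q t = 0. [:1, - 1 / t:])"
proof -
  obtain P where P: "degree P < m" "Q = 1 - pCons 0 P"
    using assms(1) by (auto simp: is_residual_poly_def)
  have "degree Q \<le> max 0 (degree (pCons 0 P))"
    unfolding P(2) using degree_diff_le_max[of 1 "pCons 0 P"] by simp
  also have "\<dots> \<le> m" using degree_pCons_le[of 0 P] P(1) by simp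
  finally show ?thesis
    by (intro poly_eq_prod_roots) (simp_all only: card, simp add: P(2))
qed

lemma finite_span_projection:
  fixes x :: "'a::real_inner"
  assumes "finite B"
  shows "\<exists>u\<in>span B. \<forall>w\<in>span B. (x - u) \<bullet> w = 0"
  using assms
proof (induction B arbitrary: x rule: finite_induct)
  case empty then show ?case by simp
next
  case (insert a B)
  obtain u where u: "u \<in> span B" "\<And>w. w \<in> span B \<Longrightarrow> (x - u) \<bullet> w = 0" using insert.IH by blast
  obtain a' where a': "a' \<in> span B" "\<And>w. w \<in> span B \<Longrightarrow> (a - a') \<bullet> w = 0" using insert.IH by blast
  define d where "d = a - a'"
  define k where "k = (x - u) \<bullet> d / (d \<bullet> d)"
  have sub: "span B \<subseteq> span (insert a B)" by (rule span_mono) auto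
  have dspan: "d \<in> span (insert a B)"
    unfolding d_def by (rule span_diff) (use a'(1) sub in \<open>auto intro: span_base\<close>)
  have kd: "k * (d \<bullet> d) = (x - u) \<bullet> d" by (simp add: k_def)
  show ?case
  proof (intro bexI[of _ "u + k *\<^sub>R d"] ballI)
    show "u + k *\<^sub>R d \<in> span (insert a B)" using u(1) sub dspan by (auto intro: span_add span_scale)
    fix w assume "w \<in> span (insert a B)"
    then obtain l where l: "w - l *\<^sub>R a \<in> span B" unfolding span_insert by auto
    define w' where "w' = (w - l *\<^sub>R a) + l *\<^sub>R a'"
    have w': "w' \<in> span B" unfolding w'_def using l a'(1) by (auto intro: span_add span_scale)
    have w: "w = w' + l *\<^sub>R d" by (simp add: w'_def d_def scaleR_diff_right)
    have "(x - (u + k *\<^sub>R d)) \<bullet> d = 0" using kd by (simp add: inner_diff_left inner_add_left)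
    moreover have "(x - (u + k *\<^sub>R d)) \<bullet> w' = 0"
      using u(2)[OF w'] a'(2)[OF w'] by (simp add: inner_diff_left inner_add_left d_def)
    ultimately show "(x - (u + k *\<^sub>R d)) \<bullet> w = 0" by (simp add: w inner_add_right)
  qed
qed

lemma poly_op_in_krylov:
  assumes "linear A" "degree p < m" shows "poly_op p A r \<in> krylov A r m"
  unfolding poly_op_def krylov_def
  by (intro span_sum span_scale span_base) (use assms in auto)

text \<open>The minimum is attained because the image of the Krylov space under \<open>A\<close> is finite-dimensional: the
orthogonal projection of \<open>r\<close> to it is \<open>A b0\<close> for some \<open>b0\<close>, and by Pythagoras every minimizer has the
same image.  Without existence, \<open>pls\<close> would be an arbitrary choice.\<close>

lemma pls_residual_orthogonal:
  fixes A :: "'a::real_inner \<Rightarrow> 'a"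
  assumes A: "linear A" and b: "b \<in> krylov A r m"
  shows "(r - A (pls A r m)) \<bullet> A b = 0"
proof -
  let ?V = "krylov A r m" and ?f = "\<lambda>b. (norm (r - A b))\<^sup>2"
  let ?B = "{(A ^^ j) r | j. j < m}"
  have AV: "A ` ?V = span (A ` ?B)" unfolding krylov_def by (rule linear_span_image[OF A, symmetric])
  have "finite (A ` ?B)" by (intro finite_imageI finite_image_set) simp
  then obtain u where u: "u \<in> A ` ?V" "\<And>w. w \<in> A ` ?V \<Longrightarrow> (r - u) \<bullet> w = 0"
    using finite_span_projection[of "A ` ?B" r] unfolding AV by blast
  then obtain b0 where b0: "b0 \<in> ?V" "u = A b0" by auto
  have pyth: "?f b' = (norm (r - u))\<^sup>2 + (norm (u - A b'))\<^sup>2" if "b' \<in> ?V" for b'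
  proof -
    have "(r - u) \<bullet> (u - A b') = 0"
      using u that by (simp add: inner_diff_right)
    then have "(norm ((r - u) + (u - A b')))\<^sup>2 = (norm (r - u))\<^sup>2 + (norm (u - A b'))\<^sup>2"
      by (intro norm_add_Pythagorean) (simp add: orthogonal_def)
    then show ?thesis by simp
  qed
  have "?f b0 \<le> ?f b'" if "b' \<in> ?V" for b'
    unfolding pyth[OF that] b0(2) by simp
  then have "is_arg_min ?f (\<lambda>b. b \<in> ?V) b0"
    using b0(1) by (simp add: is_arg_min_def not_less)
  then have min: "is_arg_min ?f (\<lambda>b. b \<in> ?V) (pls A r m)"
    unfolding pls_def arg_min_on_def arg_min_def by (rule someI)
  then have V: "pls A r m \<in> ?V" and "?f (pls A r m) \<le> ?f b0"
    using b0(1) by (simp_all add: is_arg_min_def not_less)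
  then have "(norm (u - A (pls A r m)))\<^sup>2 \<le> 0"
    unfolding pyth[OF V] pyth[OF b0(1)] using b0(2) by simp
  then have "u = A (pls A r m)" by simp
  then show ?thesis using u(2) b by blast
qed

context spectral_resolution
begin

text \<open>Write \<open>Q(t) = (\<theta> - t) p(t)\<close> with the smallest root \<open>\<theta>\<close>.  Orthogonality against \<open>A p(A) r\<close> says that the
spectral sum of \<open>(\<theta> - t) t p(t)\<^sup>2\<close> is zero.  Adding it to the sum of \<open>Q\<^sup>2 = (\<theta> - t)\<^sup>2 p\<^sup>2\<close> gives the sum of
\<open>(\<theta> - t) \<theta> p(t)\<^sup>2\<close>, which is negative above \<open>\<theta>\<close> and equal to \<open>damped\<^sup>2\<close> below.\<close>

lemma residual_norm_le_damped:
  assumes res: "is_residual_poly A r m Q" and m: "1 \<le> m"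
    and card: "card {t. poly Q t = 0} = m" and pos: "\<And>t. poly Q t = 0 \<Longrightarrow> 0 < t"
  shows "norm (r - A (pls A r m)) \<le> norm (fcalc (positive_roots.damped {t. poly Q t = 0}) r)"
proof -
  define Z where "Z = {t. poly Q t = 0}"
  obtain P where P: "degree P < m" "pls A r m = poly_op P A r" "Q = 1 - pCons 0 P"
    using res by (auto simp: is_residual_poly_def)
  have "card Z \<noteq> 0" using card m by (simp add: Z_def)
  then have "finite Z" "Z \<noteq> {}" by (auto intro: card_ge_0_finite)
  then interpret positive_roots Z
    by unfold_locales (use pos in \<open>auto simp: Z_def\<close>)
  define th where "th = min_root"
  have th: "0 < th" "th \<in> Z" unfolding th_def by (rule min_root_pos, rule min_root_mem)
  have Qprod: "Q = (\<Prod>t\<in>Z. [:1, - 1 / t:])"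
    unfolding Z_def by (rule residual_poly_factors[OF res card])
  have Qroot: "poly Q x = root_prod x" for x
    using arg_cong[OF Qprod, of "\<lambda>q. poly q x"] by (simp add: poly_prod root_prod_def)
  \<comment> \<open>\<open>p\<close> is \<open>Q(t) / (th - t)\<close>; with the root removed, \<open>p(A) r\<close> lies in the Krylov space.\<close>
  define p where "p = smult (1 / th) (\<Prod>t\<in>Z - {th}. [:1, - 1 / t:])"
  have pcof: "poly p x = cofactor x / th" for x
    by (simp add: p_def poly_prod cofactor_def th_def)
  have Qp: "poly Q x = (th - x) * poly p x" for x
    unfolding Qroot root_prod_eq_cofactor pcof using th by (simp add: th_def[symmetric] field_simps)
  have "degree p < m"
  proof -
    have "degree p \<le> sum (degree \<circ> (\<lambda>t. [:1, - 1 / t:])) (Z - {th})"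
      unfolding p_def using degree_prod_sum_le[of "Z - {th}" "\<lambda>t. [:1, - 1 / t:]"] finite_Z
        degree_smult_le order_trans by blast
    also have "\<dots> \<le> of_nat (card (Z - {th})) * 1"
      by (rule sum_bounded_above) (simp add: degree_pCons_le)
    also have "\<dots> < m" using th(2) finite_Z card m by (simp add: Z_def[symmetric])
    finally show ?thesis .
  qed
  then have "(r - A (pls A r m)) \<bullet> A (poly_op p A r) = 0"
    by (intro pls_residual_orthogonal linear_A poly_op_in_krylov)
  moreover have Qr: "r - A (pls A r m) = fcalc (poly Q) r"
  proof -
    have "fcalc (poly Q) r = fcalc (\<lambda>c. 1 + (- 1) * (c * poly P c)) r"
      by (rule fcalc_cong) (simp add: P(3))
    also have "\<dots> = r - fcalc (\<lambda>c. c * poly P c) r" by (simp only: fcalc_add fcalc_scale fcalc_1) simp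
    finally show ?thesis by (simp add: P(2) A_eq_fcalc poly_op_eq_fcalc fcalc_fcalc)
  qed
  ultimately have orth: "(\<Sum>c\<in>S. poly Q c * (c * poly p c) * (norm (E c r))\<^sup>2) = 0"
    by (simp add: A_eq_fcalc poly_op_eq_fcalc fcalc_fcalc inner_fcalc)
  have "(norm (fcalc (poly Q) r))\<^sup>2
      = (\<Sum>c\<in>S. (poly Q c)\<^sup>2 * (norm (E c r))\<^sup>2) + (\<Sum>c\<in>S. poly Q c * (c * poly p c) * (norm (E c r))\<^sup>2)"
    by (simp add: norm_fcalc orth)
  also have "\<dots> = (\<Sum>c\<in>S. (th - c) * th * (poly p c)\<^sup>2 * (norm (E c r))\<^sup>2)"
    unfolding sum.distrib[symmetric] Qp
    by (intro sum.cong refl) (simp add: power2_eq_square algebra_simps)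
  also have "\<dots> \<le> (\<Sum>c\<in>S. (damped c)\<^sup>2 * (norm (E c r))\<^sup>2)"
  proof (intro sum_mono mult_right_mono)
    fix c assume c: "c \<in> S"
    show "(th - c) * th * (poly p c)\<^sup>2 \<le> (damped c)\<^sup>2"
    proof (cases "c < th")
      case True
      have "(damped c)\<^sup>2 = (1 - c / th) * (cofactor c)\<^sup>2"
        unfolding th_def by (rule damped_square) (use True S_nonneg[OF c] in \<open>auto simp: th_def\<close>)
      also have "\<dots> = (th - c) * th * (poly p c)\<^sup>2"
        unfolding pcof using th by (simp add: power2_eq_square field_simps)
      finally show ?thesis by simp
    next
      case False
      then have "(th - c) * (th * (poly p c)\<^sup>2) \<le> 0"
        using th by (intro mult_nonpos_nonneg) auto
      also have "0 \<le> (damped c)\<^sup>2" by simp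
      finally show ?thesis by (simp only: mult.assoc)
    qed
  qed simp
  also have "\<dots> = (norm (fcalc damped r))\<^sup>2" by (simp add: norm_fcalc)
  finally have "norm (fcalc (poly Q) r) \<le> norm (fcalc damped r)" by (rule power2_le_imp_le) simp
  then show ?thesis unfolding Qr Z_def .
qed

end

section \<open>An orthonormal eigenbasis and the transfer of the source condition\<close>

lemma powr_two_le_one_plus_square:
  fixes t :: real
  assumes "0 \<le> t" "0 \<le> s" "s \<le> 1"
  shows "t powr (2 * s) \<le> 1 + t\<^sup>2"
proof (cases "t \<le> 1")
  case True
  then have "t powr (2 * s) \<le> 1 powr (2 * s)" using assms by (intro powr_mono2) auto
  then show ?thesis by (simp add: add_increasing2)
next
  case False
  then have "t powr (2 * s) \<le> t powr 2" using assms by (intro powr_mono) auto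
  then show ?thesis using False by simp
qed

lemma norm_funpow_le:
  fixes A :: "'a::real_normed_vector \<Rightarrow> 'a"
  assumes "\<And>x. norm (A x) \<le> D * norm x" "0 \<le> D"
  shows "norm ((A ^^ k) x) \<le> D ^ k * norm x"
proof (induction k)
  case (Suc k)
  have "norm ((A ^^ Suc k) x) \<le> D * norm ((A ^^ k) x)" using assms(1) by simp
  also have "\<dots> \<le> D * (D ^ k * norm x)" using Suc assms(2) by (rule mult_left_mono)
  finally show ?case by simp
qed simp

lemma norm_funpow_diff_le:
  fixes A K :: "'a::real_normed_vector \<Rightarrow> 'a"
  assumes A: "linear A" and "\<And>x. norm (A x) \<le> D * norm x" and "\<And>x. norm (K x) \<le> D * norm x" and D: "1 \<le> D"
    and diff: "\<And>x. norm (K x - A x) \<le> d * norm x" and d: "0 \<le> d"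
  shows "norm ((K ^^ k) x - (A ^^ k) x) \<le> real k * D ^ k * d * norm x"
proof (induction k)
  case (Suc k)
  have "(K ^^ Suc k) x - (A ^^ Suc k) x = (K ((K ^^ k) x) - A ((K ^^ k) x)) + A ((K ^^ k) x - (A ^^ k) x)"
    by (simp add: linear_diff[OF A])
  also have "norm \<dots> \<le> d * norm ((K ^^ k) x) + D * norm ((K ^^ k) x - (A ^^ k) x)"
    by (intro norm_triangle_le add_mono diff assms(2))
  also have "\<dots> \<le> d * (D ^ k * norm x) + D * (real k * D ^ k * d * norm x)"
    using Suc d D by (intro add_mono mult_left_mono norm_funpow_le assms(3)) auto
  also have "d * (D ^ k * norm x) \<le> d * (D ^ Suc k * norm x)"
    using d D by (intro mult_left_mono mult_right_mono power_increasing) auto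
  finally show ?case by (simp add: algebra_simps)
qed simp

locale eigenbasis =
  fixes K :: "'a::{real_inner,banach} \<Rightarrow> 'a" and J :: "nat set" and lam :: "nat \<Rightarrow> real" and v :: "nat \<Rightarrow> 'a"
  assumes decomp: "spectral_decomposition K J lam v" and no_zero_eigenvalue: "\<not> is_eigenvalue K 0"
begin

lemma lam_nonneg: "j \<in> J \<Longrightarrow> 0 \<le> lam j"
  and orthonormal: "i \<in> J \<Longrightarrow> j \<in> J \<Longrightarrow> v i \<bullet> v j = (if i = j then 1 else 0)"
  and K_has_sum: "((\<lambda>j. lam j *\<^sub>R tensor_sq (v j) b) has_sum K b) J"
  using decomp by (simp_all add: spectral_decomposition_def)

lemma inner_has_sum_coefficient:
  assumes "((\<lambda>j. c j *\<^sub>R v j) has_sum y) J" "i \<in> J"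
  shows "v i \<bullet> y = c i"
proof -
  have "((\<lambda>j. v i \<bullet> (c j *\<^sub>R v j)) has_sum v i \<bullet> y) J"
    using has_sum_bounded_linear[OF bounded_linear_inner_right assms(1), of "v i"] by (simp add: o_def)
  moreover have "((\<lambda>j. v i \<bullet> (c j *\<^sub>R v j)) has_sum (\<Sum>j\<in>{i}. v i \<bullet> (c j *\<^sub>R v j))) J"
    by (rule has_sum_finite_neutralI[where B = "{i}"]) (use assms(2) orthonormal in \<open>simp_all add: subset_iff\<close>)
  ultimately have "v i \<bullet> y = (\<Sum>j\<in>{i}. v i \<bullet> (c j *\<^sub>R v j))" by (rule has_sum_unique)
  then show ?thesis using assms(2) orthonormal by simp
qed

lemma inner_K: assumes "j \<in> J" shows "v j \<bullet> K b = lam j * (v j \<bullet> b)"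
  by (rule inner_has_sum_coefficient[OF _ assms]) (use K_has_sum[of b] in \<open>simp add: tensor_sq_def\<close>)

text \<open>The system \<open>v\<close> is complete because \<open>K\<close> is injective: a vector orthogonal to every \<open>v j\<close> is mapped to 0.\<close>

lemma eq_0_if_orthogonal:
  assumes "\<And>j. j \<in> J \<Longrightarrow> v j \<bullet> b = 0" shows "b = 0"
proof -
  have "((\<lambda>j. lam j *\<^sub>R tensor_sq (v j) b) has_sum 0) J"
    by (rule has_sum_0) (simp add: tensor_sq_def assms)
  then have "K b = 0" using K_has_sum has_sum_unique by blast
  then show ?thesis using no_zero_eigenvalue by (auto simp: is_eigenvalue_def)
qed

lemma eq_if_coordinates_eq:
  assumes "\<And>j. j \<in> J \<Longrightarrow> v j \<bullet> x = v j \<bullet> y" shows "x = y"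
  using eq_0_if_orthogonal[of "x - y"] assms by (simp add: inner_diff_right)

lemma K_eigenvector: "j \<in> J \<Longrightarrow> K (v j) = lam j *\<^sub>R v j"
  by (rule eq_if_coordinates_eq) (simp add: inner_K orthonormal)

lemma lam_pos: assumes "j \<in> J" shows "0 < lam j"
proof -
  have "v j \<noteq> 0" using orthonormal[OF assms assms] by auto
  then have "lam j \<noteq> 0" using K_eigenvector[OF assms] no_zero_eigenvalue unfolding is_eigenvalue_def by metis
  then show ?thesis using lam_nonneg[OF assms] by simp
qed

lemma inner_sum_orthonormal:
  assumes "finite F" "F \<subseteq> J" "j \<in> J"
  shows "v j \<bullet> (\<Sum>i\<in>F. c i *\<^sub>R v i) = (if j \<in> F then c j else 0)"
proof -
  have "v j \<bullet> (\<Sum>i\<in>F. c i *\<^sub>R v i) = (\<Sum>i\<in>F. if i = j then c i else 0)"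
    unfolding inner_sum_right
  proof (intro sum.cong refl)
    fix i assume "i \<in> F"
    then have "v j \<bullet> v i = (if j = i then 1 else 0)" using assms by (intro orthonormal) auto
    then show "v j \<bullet> (c i *\<^sub>R v i) = (if i = j then c i else 0)" by simp
  qed
  then show ?thesis using assms(1) by simp
qed

lemma norm_sum_orthonormal:
  assumes "finite F" "F \<subseteq> J"
  shows "(norm (\<Sum>i\<in>F. c i *\<^sub>R v i))\<^sup>2 = (\<Sum>i\<in>F. (c i)\<^sup>2)"
proof -
  have "(norm (\<Sum>i\<in>F. c i *\<^sub>R v i))\<^sup>2 = (\<Sum>j\<in>F. c j * (v j \<bullet> (\<Sum>i\<in>F. c i *\<^sub>R v i)))"
    unfolding power2_norm_eq_inner by (simp only: inner_sum_left inner_scaleR_left)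
  also have "\<dots> = (\<Sum>j\<in>F. c j * c j)"
  proof (intro sum.cong refl)
    fix j assume "j \<in> F"
    then show "c j * (v j \<bullet> (\<Sum>i\<in>F. c i *\<^sub>R v i)) = c j * c j"
      using inner_sum_orthonormal[OF assms, of j c] assms(2) by (simp only: subsetD if_True)
  qed
  finally show ?thesis by (simp add: power2_eq_square)
qed

lemma bessel:
  assumes "finite F" "F \<subseteq> J"
  shows "(\<Sum>j\<in>F. (v j \<bullet> x)\<^sup>2) \<le> (norm x)\<^sup>2"
proof -
  define p where "p = (\<Sum>j\<in>F. (v j \<bullet> x) *\<^sub>R v j)"
  have pp: "p \<bullet> p = (\<Sum>j\<in>F. (v j \<bullet> x)\<^sup>2)"
    using norm_sum_orthonormal[OF assms, of "\<lambda>j. v j \<bullet> x"] by (simp add: p_def power2_norm_eq_inner)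
  have px: "p \<bullet> x = (\<Sum>j\<in>F. (v j \<bullet> x)\<^sup>2)" by (simp add: p_def inner_sum_left power2_eq_square)
  have "0 \<le> (x - p) \<bullet> (x - p)" by simp
  also have "\<dots> = x \<bullet> x - p \<bullet> p"
    using pp px by (simp add: inner_diff_left inner_diff_right inner_commute)
  finally show ?thesis by (simp add: pp power2_norm_eq_inner)
qed

text \<open>By Bessel's inequality the Fourier series of \<open>x\<close> is a Cauchy series; its sum has the same coordinates as
\<open>x\<close>, and the system is complete.\<close>

lemma parseval: "(\<lambda>j. if j \<in> J then (v j \<bullet> x)\<^sup>2 else 0) sums (norm x)\<^sup>2"
proof -
  define a where "a j = (if j \<in> J then (v j \<bullet> x)\<^sup>2 else 0)" for j
  define f where "f j = (if j \<in> J then (v j \<bullet> x) *\<^sub>R v j else 0)" for j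
  have sum_f: "sum f I = (\<Sum>j\<in>I \<inter> J. (v j \<bullet> x) *\<^sub>R v j)" if "finite I" for I
    unfolding f_def using that by (rule sum.inter_restrict[symmetric])
  have sum_a: "sum a I = (\<Sum>j\<in>I \<inter> J. (v j \<bullet> x)\<^sup>2)" if "finite I" for I
    unfolding a_def using that by (rule sum.inter_restrict[symmetric])
  have norm_sum_f: "(norm (sum f I))\<^sup>2 = sum a I" if "finite I" for I
    unfolding sum_f[OF that] sum_a[OF that] using that by (intro norm_sum_orthonormal) auto
  have a0: "0 \<le> a j" for j by (simp add: a_def)
  have "summable a"
  proof (rule bounded_imp_summable[OF a0])
    fix n show "sum a {..n} \<le> (norm x)\<^sup>2"
      unfolding sum_a[OF finite_atMost] by (rule bessel) auto
  qed
  have "summable f"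
    unfolding summable_Cauchy
  proof (intro allI impI)
    fix e :: real assume "0 < e"
    then obtain N where N: "\<And>m n. N \<le> m \<Longrightarrow> norm (sum a {m..<n}) < e\<^sup>2"
      using \<open>summable a\<close> unfolding summable_Cauchy by (meson zero_less_power)
    have "norm (sum f {m..<n}) < e" if "N \<le> m" for m n
    proof (rule power2_less_imp_less)
      have "(norm (sum f {m..<n}))\<^sup>2 = sum a {m..<n}" by (rule norm_sum_f) simp
      also have "\<dots> < e\<^sup>2" using N[OF that, of n] by simp
      finally show "(norm (sum f {m..<n}))\<^sup>2 < e\<^sup>2" .
    qed (use \<open>0 < e\<close> in simp)
    then show "\<exists>N. \<forall>m\<ge>N. \<forall>n. norm (sum f {m..<n}) < e" by blast
  qed
  then have f: "f sums suminf f" by (rule summable_sums)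
  have "suminf f = x"
  proof (rule eq_if_coordinates_eq)
    fix j assume j: "j \<in> J"
    have "(\<lambda>i. v j \<bullet> f i) sums (v j \<bullet> suminf f)"
      by (rule bounded_linear.sums[OF bounded_linear_inner_right f])
    moreover have "(\<lambda>i. v j \<bullet> f i) sums (\<Sum>i\<in>{j}. v j \<bullet> f i)"
      by (rule sums_finite) (use j in \<open>auto simp: f_def orthonormal\<close>)
    ultimately have "v j \<bullet> suminf f = (\<Sum>i\<in>{j}. v j \<bullet> f i)" by (rule sums_unique2)
    then show "v j \<bullet> suminf f = v j \<bullet> x" using j by (simp add: f_def orthonormal)
  qed
  then have "(\<lambda>n. (norm (sum f {..<n}))\<^sup>2) \<longlonglongrightarrow> (norm x)\<^sup>2"
    using f unfolding sums_def by (auto intro!: tendsto_intros)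
  then show ?thesis unfolding sums_def norm_sum_f[OF finite_lessThan] a_def .
qed

text \<open>Reduces norm bounds to finite sets of coordinates, so that no convergence has to be discussed when
coordinates are estimated.\<close>

lemma norm_sq_le_if_coordinates:
  assumes "\<And>F. finite F \<Longrightarrow> F \<subseteq> J \<Longrightarrow> (\<Sum>j\<in>F. (v j \<bullet> x)\<^sup>2) \<le> b"
  shows "(norm x)\<^sup>2 \<le> b"
proof (rule LIMSEQ_le_const2)
  show "(\<lambda>n. \<Sum>j<n. if j \<in> J then (v j \<bullet> x)\<^sup>2 else 0) \<longlonglongrightarrow> (norm x)\<^sup>2"
    using parseval unfolding sums_def .
  show "\<exists>N. \<forall>n\<ge>N. (\<Sum>j<n. if j \<in> J then (v j \<bullet> x)\<^sup>2 else 0) \<le> b"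
  proof (intro exI allI impI)
    fix n :: nat
    have "(\<Sum>j<n. if j \<in> J then (v j \<bullet> x)\<^sup>2 else 0) = (\<Sum>j\<in>{..<n} \<inter> J. (v j \<bullet> x)\<^sup>2)"
      by (rule sum.inter_restrict[symmetric]) simp
    also have "\<dots> \<le> b" by (rule assms) auto
    finally show "(\<Sum>j<n. if j \<in> J then (v j \<bullet> x)\<^sup>2 else 0) \<le> b" .
  qed
qed

lemma norm_le_if_coordinates_dominated:
  assumes "\<And>j. j \<in> J \<Longrightarrow> \<bar>v j \<bullet> y\<bar> \<le> b * \<bar>v j \<bullet> x\<bar>" "0 \<le> b"
  shows "norm y \<le> b * norm x"
proof -
  have "(norm y)\<^sup>2 \<le> (b * norm x)\<^sup>2"
  proof (rule norm_sq_le_if_coordinates)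
    fix F assume F: "finite F" "F \<subseteq> J"
    have "(\<Sum>j\<in>F. (v j \<bullet> y)\<^sup>2) \<le> (\<Sum>j\<in>F. b\<^sup>2 * (v j \<bullet> x)\<^sup>2)"
    proof (rule sum_mono)
      fix j assume "j \<in> F"
      then have "(\<bar>v j \<bullet> y\<bar>)\<^sup>2 \<le> (b * \<bar>v j \<bullet> x\<bar>)\<^sup>2" using F assms(1) by (intro power_mono) auto
      then show "(v j \<bullet> y)\<^sup>2 \<le> b\<^sup>2 * (v j \<bullet> x)\<^sup>2" by (simp add: power_mult_distrib)
    qed
    also have "\<dots> \<le> b\<^sup>2 * (norm x)\<^sup>2"
      unfolding sum_distrib_left[symmetric] by (intro mult_left_mono bessel F) simp
    finally show "(\<Sum>j\<in>F. (v j \<bullet> y)\<^sup>2) \<le> (b * norm x)\<^sup>2" by (simp add: power_mult_distrib)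
  qed
  then show ?thesis by (rule power2_le_imp_le) (use assms(2) in simp)
qed

lemma norm_K_le:
  assumes "\<And>j. j \<in> J \<Longrightarrow> lam j \<le> D" "0 \<le> D"
  shows "norm (K x) \<le> D * norm x"
  by (rule norm_le_if_coordinates_dominated)
     (use assms lam_nonneg in \<open>auto simp: inner_K abs_mult intro!: mult_right_mono\<close>)

lemma hilbert_schmidt_bound:
  assumes adj: "\<And>j. j \<in> J \<Longrightarrow> v j \<bullet> T x = T (v j) \<bullet> x"
    and HS: "\<And>F. finite F \<Longrightarrow> F \<subseteq> J \<Longrightarrow> (\<Sum>j\<in>F. (norm (T (v j)))\<^sup>2) \<le> h\<^sup>2" and h: "0 \<le> h"
  shows "norm (T x) \<le> h * norm x"
proof -
  have "(norm (T x))\<^sup>2 \<le> (h * norm x)\<^sup>2"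
  proof (rule norm_sq_le_if_coordinates)
    fix F assume F: "finite F" "F \<subseteq> J"
    have "(\<Sum>j\<in>F. (v j \<bullet> T x)\<^sup>2) \<le> (\<Sum>j\<in>F. (norm (T (v j)))\<^sup>2 * (norm x)\<^sup>2)"
    proof (rule sum_mono)
      fix j assume "j \<in> F"
      then have "v j \<bullet> T x = T (v j) \<bullet> x" using adj F(2) by blast
      then have "\<bar>v j \<bullet> T x\<bar> \<le> norm (T (v j)) * norm x" by (simp only: Cauchy_Schwarz_ineq2)
      then have "(\<bar>v j \<bullet> T x\<bar>)\<^sup>2 \<le> (norm (T (v j)) * norm x)\<^sup>2" by (rule power_mono) simp
      then show "(v j \<bullet> T x)\<^sup>2 \<le> (norm (T (v j)))\<^sup>2 * (norm x)\<^sup>2" by (simp add: power_mult_distrib)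
    qed
    also have "\<dots> \<le> h\<^sup>2 * (norm x)\<^sup>2"
      unfolding sum_distrib_right[symmetric] by (intro mult_right_mono HS F) simp
    finally show "(\<Sum>j\<in>F. (v j \<bullet> T x)\<^sup>2) \<le> (h * norm x)\<^sup>2" by (simp add: power_mult_distrib)
  qed
  then show ?thesis by (rule power2_le_imp_le) (use h in simp)
qed

text \<open>If the series that defines \<open>K\<^sup>s e\<close> did not converge, its value would be 0 by convention and the bound would
be trivial; so its convergence needs no proof.\<close>

lemma op_powr_interpolation:
  assumes s: "0 \<le> s" "s \<le> 1" and q: "0 < q"
  shows "(norm (op_powr J lam v s e))\<^sup>2 \<le> q powr (- 2 * s) * ((norm e)\<^sup>2 + q\<^sup>2 * (norm (K e))\<^sup>2)"
    (is "_ \<le> ?b")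
proof -
  have b0: "0 \<le> ?b" by simp
  consider "s = 0" | "s \<noteq> 0" "(\<lambda>j. (lam j powr s) *\<^sub>R tensor_sq (v j) e) summable_on J"
    | "s \<noteq> 0" "\<not> (\<lambda>j. (lam j powr s) *\<^sub>R tensor_sq (v j) e) summable_on J" by blast
  then show ?thesis
  proof cases
    case 1 then show ?thesis using q by (simp add: op_powr_def)
  next
    case 2
    define y where "y = op_powr J lam v s e"
    have "((\<lambda>j. (lam j powr s) *\<^sub>R tensor_sq (v j) e) has_sum y) J"
      using 2 by (simp add: y_def op_powr_def has_sum_infsum)
    then have y: "v j \<bullet> y = lam j powr s * (v j \<bullet> e)" if "j \<in> J" for j
      using inner_has_sum_coefficient[of "\<lambda>j. lam j powr s * (v j \<bullet> e)" y j] that by (simp add: tensor_sq_def)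
    have "(norm y)\<^sup>2 \<le> ?b"
    proof (rule norm_sq_le_if_coordinates)
      fix F assume F: "finite F" "F \<subseteq> J"
      have "(\<Sum>j\<in>F. (v j \<bullet> y)\<^sup>2) \<le> (\<Sum>j\<in>F. q powr (- 2 * s) * ((v j \<bullet> e)\<^sup>2 + q\<^sup>2 * (v j \<bullet> K e)\<^sup>2))"
      proof (rule sum_mono)
        fix j assume "j \<in> F"
        then have j: "j \<in> J" using F by auto
        have "(lam j powr s)\<^sup>2 = q powr (- 2 * s) * (q * lam j) powr (2 * s)"
        proof -
          have "q powr (- 2 * s) * q powr (2 * s) = 1" using q by (simp flip: powr_add)
          moreover have "(lam j powr s)\<^sup>2 = lam j powr (2 * s)"
            by (simp add: power2_eq_square flip: powr_add)
          ultimately show ?thesis using q lam_pos[OF j] by (simp add: powr_mult)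
        qed
        also have "\<dots> \<le> q powr (- 2 * s) * (1 + (q * lam j)\<^sup>2)"
          using q s lam_pos[OF j] by (intro mult_left_mono powr_two_le_one_plus_square) auto
        finally have "(lam j powr s)\<^sup>2 * (v j \<bullet> e)\<^sup>2 \<le> q powr (- 2 * s) * (1 + (q * lam j)\<^sup>2) * (v j \<bullet> e)\<^sup>2"
          by (rule mult_right_mono) simp
        then show "(v j \<bullet> y)\<^sup>2 \<le> q powr (- 2 * s) * ((v j \<bullet> e)\<^sup>2 + q\<^sup>2 * (v j \<bullet> K e)\<^sup>2)"
          by (simp add: y[OF j] inner_K[OF j] power_mult_distrib algebra_simps)
      qed
      also have "\<dots> = q powr (- 2 * s) * ((\<Sum>j\<in>F. (v j \<bullet> e)\<^sup>2) + q\<^sup>2 * (\<Sum>j\<in>F. (v j \<bullet> K e)\<^sup>2))"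
        by (simp add: sum.distrib flip: sum_distrib_left)
      also have "\<dots> \<le> ?b" by (intro mult_left_mono add_mono bessel F) auto
      finally show "(\<Sum>j\<in>F. (v j \<bullet> y)\<^sup>2) \<le> ?b" .
    qed
    then show ?thesis by (simp add: y_def)
  next
    case 3
    then show ?thesis using b0 by (simp add: op_powr_def infsum_not_exists)
  qed
qed

text \<open>The operator \<open>T\<close> stands for a function of \<open>A\<close> that is small like \<open>a\<^sup>j\<close> against \<open>A\<^sup>j\<close>, up to the first
integer above \<open>\<mu>\<close>.  The same smallness is inherited against \<open>K\<^sup>\<mu>\<close>, up to \<open>d \<ge> \<parallel>K - A\<parallel>\<close>.

Put \<open>k = \<lfloor>\<mu>\<rfloor>\<close> and \<open>\<beta> = K\<^sup>\<mu> u\<close>.  The part of \<open>\<beta>\<close> on eigenvalues at most \<open>a\<close> has norm at most \<open>a\<^sup>\<mu> R\<close>.  The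
other part \<open>g 0\<close> is a finite sum, so \<open>g i = K^(\<mu>-i) u\<close> restricted to eigenvalues above \<open>a\<close> exists for every
\<open>i\<close>, and \<open>g 0 = K\<^sup>k g k\<close> with \<open>g k = K (g (k + 1))\<close>.  Replacing \<open>K\<^sup>k\<close> by \<open>A\<^sup>k\<close> costs a multiple of \<open>d\<close>.
Replacing the last \<open>K\<close> by \<open>A\<close> is harmless because \<open>d\<close> is at most of the order of \<open>a\<close>, and
\<open>\<parallel>g (k + 1)\<parallel> \<le> a^(\<mu>-k-1) R\<close> then makes up for \<open>T A^(k+1)\<close>.  For \<open>\<mu> < 1\<close> the term with \<open>d\<close> is absent.\<close>

lemma source_transfer:
  assumes T: "linear T" and A: "linear A"
    and TA: "\<And>j x. j \<le> Suc k \<Longrightarrow> norm (T ((A ^^ j) x)) \<le> c * a ^ j * norm x" and c: "0 \<le> c"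
    and k: "k = nat \<lfloor>\<mu>\<rfloor>" and mu: "0 < \<mu>" and a: "0 < a"
    and bounds: "\<And>x. norm (A x) \<le> D * norm x" "\<And>j. j \<in> J \<Longrightarrow> lam j \<le> D" "1 \<le> D"
    and diff: "\<And>x. norm (K x - A x) \<le> d * norm x" and d: "0 \<le> d" "d \<le> C * a"
    and fin: "finite {j \<in> J. a < lam j}"
    and source: "\<And>F. finite F \<Longrightarrow> F \<subseteq> J \<Longrightarrow> (\<Sum>j\<in>F. (\<beta> \<bullet> v j)\<^sup>2 / (lam j powr (2 * \<mu>))) \<le> R\<^sup>2"
    and R: "0 \<le> R"
  shows "norm (T \<beta>) \<le> c * R * ((2 + C) * a powr \<mu> + real k * D ^ Suc k * d)"
proof -
  define L where "L = {j \<in> J. a < lam j}"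
  have L: "finite L" "L \<subseteq> J" using fin by (auto simp: L_def)
  define u where "u j = (v j \<bullet> \<beta>) / lam j powr \<mu>" for j
  have u_source: "(\<Sum>j\<in>F. (u j)\<^sup>2) \<le> R\<^sup>2" if "finite F" "F \<subseteq> J" for F
  proof -
    have "(\<Sum>j\<in>F. (u j)\<^sup>2) = (\<Sum>j\<in>F. (\<beta> \<bullet> v j)\<^sup>2 / (lam j powr (2 * \<mu>)))"
      by (intro sum.cong refl) (simp add: u_def power_divide inner_commute power2_eq_square powr_add[symmetric])
    then show ?thesis using source[OF that] by simp
  qed
  have vu: "v j \<bullet> \<beta> = lam j powr \<mu> * u j" if "j \<in> J" for j
    using lam_pos[OF that] by (simp add: u_def)
  \<comment> \<open>\<open>K^(\<mu>-i)\<close> applied to the part of \<open>u\<close> on eigenvalues above \<open>a\<close>\<close>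
  define g where "g i = (\<Sum>j\<in>L. (lam j powr (\<mu> - real i) * u j) *\<^sub>R v j)" for i :: nat
  have g_coord: "v j \<bullet> g i = (if j \<in> L then lam j powr (\<mu> - real i) * u j else 0)" if "j \<in> J" for i j
    unfolding g_def by (rule inner_sum_orthonormal[OF L that])
  have K_g: "K (g (Suc i)) = g i" for i
  proof (rule eq_if_coordinates_eq)
    fix j assume j: "j \<in> J"
    have "lam j * lam j powr (\<mu> - real (Suc i)) = lam j powr (1 + (\<mu> - real (Suc i)))"
      using lam_nonneg[OF j] by (rule powr_mult_base)
    also have "\<dots> = lam j powr (\<mu> - real i)" by simp
    finally show "v j \<bullet> K (g (Suc i)) = v j \<bullet> g i"
      using j by (simp add: inner_K g_coord mult.assoc[symmetric])
  qed
  have K_pow_g: "(K ^^ i) (g i) = g 0" for i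
  proof (induction i)
    case (Suc i)
    have "(K ^^ Suc i) (g (Suc i)) = (K ^^ i) (K (g (Suc i)))" by (simp only: funpow_Suc_right o_apply)
    then show ?case by (simp only: K_g Suc)
  qed simp
  have g_norm: "norm (g i) \<le> b * R" if b: "\<And>j. j \<in> L \<Longrightarrow> lam j powr (\<mu> - real i) \<le> b" "0 \<le> b" for i b
  proof -
    have "(norm (g i))\<^sup>2 = (\<Sum>j\<in>L. (lam j powr (\<mu> - real i) * u j)\<^sup>2)"
      unfolding g_def by (rule norm_sum_orthonormal[OF L])
    also have "\<dots> \<le> (\<Sum>j\<in>L. b\<^sup>2 * (u j)\<^sup>2)"
      unfolding power_mult_distrib by (intro sum_mono mult_right_mono power_mono b) auto
    also have "\<dots> \<le> b\<^sup>2 * R\<^sup>2"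
      unfolding sum_distrib_left[symmetric] by (intro mult_left_mono u_source L) simp
    finally have "(norm (g i))\<^sup>2 \<le> (b * R)\<^sup>2" by (simp add: power_mult_distrib)
    then show ?thesis by (rule power2_le_imp_le) (use b(2) R in simp)
  qed
  have k_floor: "real k \<le> \<mu>" "\<mu> < real k + 1" unfolding k using mu by linarith+
  have gk: "norm (g k) \<le> D * R"
  proof (rule g_norm)
    fix j assume "j \<in> L"
    then have "0 < lam j" "lam j \<le> D" using L(2) lam_pos bounds(2) by auto
    then have "lam j powr (\<mu> - real k) \<le> D powr (\<mu> - real k)" using k_floor by (intro powr_mono2) auto
    also have "\<dots> \<le> D powr 1" using k_floor bounds(3) by (intro powr_mono) auto
    finally show "lam j powr (\<mu> - real k) \<le> D" using bounds(3) by simp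
  qed (use bounds(3) in simp)
  have gSk: "norm (g (Suc k)) \<le> a powr (\<mu> - real (Suc k)) * R"
  proof (rule g_norm)
    fix j assume "j \<in> L"
    then have "a < lam j" by (simp add: L_def)
    then show "lam j powr (\<mu> - real (Suc k)) \<le> a powr (\<mu> - real (Suc k))"
      using a k_floor by (intro powr_mono2') auto
  qed simp
  have low: "norm (\<beta> - g 0) \<le> a powr \<mu> * R"
  proof -
    have "(norm (\<beta> - g 0))\<^sup>2 \<le> (a powr \<mu> * R)\<^sup>2"
    proof (rule norm_sq_le_if_coordinates)
      fix F assume F: "finite F" "F \<subseteq> J"
      have "(\<Sum>j\<in>F. (v j \<bullet> (\<beta> - g 0))\<^sup>2) \<le> (\<Sum>j\<in>F. (a powr \<mu>)\<^sup>2 * (u j)\<^sup>2)"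
      proof (rule sum_mono)
        fix j assume "j \<in> F"
        then have j: "j \<in> J" using F by auto
        show "(v j \<bullet> (\<beta> - g 0))\<^sup>2 \<le> (a powr \<mu>)\<^sup>2 * (u j)\<^sup>2"
        proof (cases "j \<in> L")
          case True
          then show ?thesis using j by (simp add: inner_diff_right g_coord vu)
        next
          case False
          then have "lam j powr \<mu> \<le> a powr \<mu>"
            using j lam_nonneg[OF j] mu by (intro powr_mono2) (auto simp: L_def)
          then have "(lam j powr \<mu>)\<^sup>2 * (u j)\<^sup>2 \<le> (a powr \<mu>)\<^sup>2 * (u j)\<^sup>2"
            by (intro mult_right_mono power_mono) auto
          then show ?thesis using False j by (simp add: inner_diff_right g_coord vu power_mult_distrib)
        qed
      qed
      also have "\<dots> \<le> (a powr \<mu>)\<^sup>2 * R\<^sup>2"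
        unfolding sum_distrib_left[symmetric] by (intro mult_left_mono u_source F) simp
      finally show "(\<Sum>j\<in>F. (v j \<bullet> (\<beta> - g 0))\<^sup>2) \<le> (a powr \<mu> * R)\<^sup>2" by (simp add: power_mult_distrib)
    qed
    then show ?thesis by (rule power2_le_imp_le) (use R in simp)
  qed
  have T_le: "norm (T x) \<le> c * norm x" for x using TA[of 0 x] by simp
  have K_le: "norm (K x) \<le> D * norm x" for x by (rule norm_K_le) (use bounds in auto)
  \<comment> \<open>The four parts: low eigenvalues, \<open>K\<^sup>k - A\<^sup>k\<close>, \<open>A\<^sup>k (K - A)\<close>, and \<open>A^(k+1)\<close>.\<close>
  have "\<beta> = (\<beta> - g 0) + ((K ^^ k) (g k) - (A ^^ k) (g k)) + (A ^^ k) (K (g (Suc k)) - A (g (Suc k)))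
      + (A ^^ Suc k) (g (Suc k))"
    unfolding K_pow_g funpow_Suc_right o_apply linear_diff[OF linear_funpow[OF A]] K_g by simp
  then have "T \<beta> = T (\<beta> - g 0) + T ((K ^^ k) (g k) - (A ^^ k) (g k))
      + T ((A ^^ k) (K (g (Suc k)) - A (g (Suc k)))) + T ((A ^^ Suc k) (g (Suc k)))"
    by (metis linear_add[OF T])
  also have "norm \<dots> \<le> c * (a powr \<mu> * R) + c * (real k * D ^ k * d * (D * R))
      + c * a ^ k * (C * a * (a powr (\<mu> - real (Suc k)) * R)) + c * a ^ Suc k * (a powr (\<mu> - real (Suc k)) * R)"
  proof (intro norm_triangle_le add_mono)
    show "norm (T (\<beta> - g 0)) \<le> c * (a powr \<mu> * R)"
      using T_le low c by (meson mult_left_mono order_trans)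
    have "norm ((K ^^ k) (g k) - (A ^^ k) (g k)) \<le> real k * D ^ k * d * norm (g k)"
      by (rule norm_funpow_diff_le[OF A bounds(1) K_le bounds(3) diff d(1)])
    also have "\<dots> \<le> real k * D ^ k * d * (D * R)"
      using gk d(1) bounds(3) by (intro mult_left_mono) auto
    finally show "norm (T ((K ^^ k) (g k) - (A ^^ k) (g k))) \<le> c * (real k * D ^ k * d * (D * R))"
      using T_le c by (meson mult_left_mono order_trans)
    have "norm (K (g (Suc k)) - A (g (Suc k))) \<le> d * norm (g (Suc k))" by (rule diff)
    also have "\<dots> \<le> (C * a) * (a powr (\<mu> - real (Suc k)) * R)"
      using d gSk by (intro mult_mono) auto
    finally have "c * a ^ k * norm (K (g (Suc k)) - A (g (Suc k))) \<le> c * a ^ k * (C * a * (a powr (\<mu> - real (Suc k)) * R))"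
      using c a by (intro mult_left_mono) auto
    then show "norm (T ((A ^^ k) (K (g (Suc k)) - A (g (Suc k))))) \<le> c * a ^ k * (C * a * (a powr (\<mu> - real (Suc k)) * R))"
      using TA[of k "K (g (Suc k)) - A (g (Suc k))"] by simp
    have "c * a ^ Suc k * norm (g (Suc k)) \<le> c * a ^ Suc k * (a powr (\<mu> - real (Suc k)) * R)"
      using c a gSk by (intro mult_left_mono) auto
    then show "norm (T ((A ^^ Suc k) (g (Suc k)))) \<le> c * a ^ Suc k * (a powr (\<mu> - real (Suc k)) * R)"
      using TA[of "Suc k" "g (Suc k)"] by simp
  qed
  also have "\<dots> = c * R * (a powr \<mu> + real k * D ^ Suc k * d + (1 + C) * (a ^ Suc k * a powr (\<mu> - real (Suc k))))"
    by (simp add: algebra_simps)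
  also have "a ^ Suc k * a powr (\<mu> - real (Suc k)) = a powr \<mu>"
    using a by (simp add: powr_realpow[symmetric] powr_add[symmetric] del: power_Suc)
  finally show ?thesis by (simp add: algebra_simps)
qed

lemma finite_lam_above:
  assumes "\<And>F. finite F \<Longrightarrow> F \<subseteq> J \<Longrightarrow> sum lam F \<le> C" "0 < a"
  shows "finite {j \<in> J. a < lam j}"
proof (rule ccontr)
  assume "infinite {j \<in> J. a < lam j}"
  then obtain F where F: "finite F" "card F = Suc (nat \<lceil>C / a\<rceil>)" "F \<subseteq> {j \<in> J. a < lam j}"
    using infinite_arbitrarily_large by blast
  have "C < real (card F) * a"
    using assms(2) unfolding F(2) by (simp add: pos_divide_less_eq[symmetric]) linarith
  also have "\<dots> \<le> sum lam F" by (rule sum_bounded_below) (use F in auto)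
  also have "\<dots> \<le> C" by (rule assms(1)) (use F in auto)
  finally show False by simp
qed

end

section \<open>The deterministic error bound\<close>

text \<open>The constant of the final bound.  The rate in probability needs that it involves neither the sample nor
its size, so it is given explicitly.\<close>

definition pls_const :: "real \<Rightarrow> real \<Rightarrow> real \<Rightarrow> real \<Rightarrow> real" where
  "pls_const \<mu> R D G =
    (let k = nat \<lfloor>\<mu>\<rfloor>; source_const = (2 * real (k + 2)) ^ (k + 2) * R * (2 + G\<^sup>2 + real k * D ^ Suc k * G)
     in 6 * ((2 + 2 * G\<^sup>2) * source_const + 5 * G + 3 * G ^ 3)\<^sup>2)"

lemma three_term_square: "(x + y + z)\<^sup>2 \<le> 3 * (x\<^sup>2 + y\<^sup>2 + (z::real)\<^sup>2)"
proof -
  have "0 \<le> (x - y)\<^sup>2 + (y - z)\<^sup>2 + (x - z)\<^sup>2" by simp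
  then show ?thesis by (simp add: power2_eq_square algebra_simps)
qed

text \<open>The situation on the good event: \<open>err\<close> is the noise in \<open>r\<close>, and both \<open>err\<close> and \<open>K - A\<close> are of order \<open>d\<close>.
The last assumption keeps \<open>1 / |Q'(0)|\<close>, the spectral level that the estimator resolves, above the
level \<open>d\<close> of the perturbation.\<close>

locale pls_perturbation =
  eigenbasis K J lam v + spectral_resolution A S E
  for K :: "'a::{real_inner,banach} \<Rightarrow> 'a" and J lam v and A :: "'a \<Rightarrow> 'a" and S E +
  fixes \<beta> r err :: 'a and \<mu> R D G d :: real and m :: nat and Q :: "real poly"
  assumes mu: "0 < \<mu>" and R: "0 \<le> R" and D: "1 \<le> D" and G: "0 \<le> G" and d: "0 < d"
    and A_le: "\<And>x. norm (A x) \<le> D * norm x" and lam_le: "\<And>j. j \<in> J \<Longrightarrow> lam j \<le> D"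
    and fin_lam: "\<And>a. 0 < a \<Longrightarrow> finite {j \<in> J. a < lam j}"
    and source: "\<And>F. finite F \<Longrightarrow> F \<subseteq> J \<Longrightarrow> (\<Sum>j\<in>F. (\<beta> \<bullet> v j)\<^sup>2 / (lam j powr (2 * \<mu>))) \<le> R\<^sup>2"
    and r: "r = A \<beta> + err" and err: "norm err \<le> G * d"
    and diff: "\<And>x. norm (K x - A x) \<le> G * d * norm x"
    and m: "1 \<le> m" and res: "is_residual_poly A r m Q"
    and card_roots: "card {t. poly Q t = 0} = m" and roots_pos: "\<And>t. poly Q t = 0 \<Longrightarrow> 0 < t"
    and slope: "\<bar>poly (pderiv Q) 0\<bar> * d \<le> G"
begin

definition roots :: "real set" where "roots = {t. poly Q t = 0}"

sublocale positive_roots roots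
proof
  have "card roots \<noteq> 0" using card_roots m by (simp add: roots_def)
  then show "finite roots" "roots \<noteq> {}" by (auto intro: card_ge_0_finite)
qed (use roots_pos in \<open>simp add: roots_def\<close>)

lemma Q_factors: "Q = (\<Prod>t\<in>roots. [:1, - 1 / t:])"
  unfolding roots_def by (rule residual_poly_factors[OF res card_roots])

lemma poly_Q: "poly Q x = root_prod x"
  using arg_cong[OF Q_factors, of "\<lambda>q. poly q x"] by (simp add: poly_prod root_prod_def)

lemma pderiv_Q: "poly (pderiv Q) 0 = - inv_sum"
proof -
  have "pderiv Q = pderiv (\<Prod>t\<in>roots. [:1, - 1 / t:])" using Q_factors by (rule arg_cong)
  then show ?thesis
    by (simp add: pderiv_prod poly_sum poly_prod inv_sum_def pderiv_pCons sum_negf)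
qed

abbreviation "q \<equiv> inv_sum"
abbreviation "b \<equiv> pls A r m"
definition "floor_exp = nat \<lfloor>\<mu>\<rfloor>"
definition "decay_const = (2 * real (floor_exp + 2)) ^ (floor_exp + 2)"
definition "source_const = decay_const * R * (2 + G\<^sup>2 + real floor_exp * D ^ Suc floor_exp * G)"
definition "source_rate = (1 / q) powr \<mu> + d powr (min \<mu> 1)"

lemma decay_const_ge: assumes "j \<le> Suc floor_exp" shows "(2 * real (Suc j)) ^ Suc j \<le> decay_const"
proof -
  have "(2 * real (Suc j)) ^ Suc j \<le> (2 * real (floor_exp + 2)) ^ Suc j"
    using assms by (intro power_mono) auto
  also have "\<dots> \<le> decay_const" unfolding decay_const_def using assms by (intro power_increasing) auto
  finally show ?thesis .
qed

lemma decay_const_ge_1: "1 \<le> decay_const" unfolding decay_const_def by (intro one_le_power) auto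

lemma source_const_nonneg: "0 \<le> source_const"
  unfolding source_const_def using decay_const_ge_1 R D G by (intro mult_nonneg_nonneg add_nonneg_nonneg) auto

lemma source_rate_nonneg: "0 \<le> source_rate" by (simp add: source_rate_def)

text \<open>In the transfer of the source condition at the level \<open>a = 1/q\<close>, the term with \<open>d\<close> occurs only for
\<open>\<mu> \<ge> 1\<close>, where \<open>d\<close> is the second summand of \<open>source_rate\<close>.\<close>

lemma source_bound:
  assumes "linear T" and TA: "\<And>j x. j \<le> Suc floor_exp \<Longrightarrow> norm (T ((A ^^ j) x)) \<le> decay_const * (1 / q) ^ j * norm x"
  shows "norm (T \<beta>) \<le> source_const * source_rate"
proof -
  have qd: "q * d \<le> G" using slope inv_sum_pos by (simp add: pderiv_Q)
  then have "G * (q * d) \<le> G * G" using G by (rule mult_left_mono)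
  then have "G * d \<le> G\<^sup>2 * (1 / q)" using inv_sum_pos by (simp add: field_simps power2_eq_square)
  then have "norm (T \<beta>) \<le> decay_const * R * ((2 + G\<^sup>2) * (1 / q) powr \<mu> + real floor_exp * D ^ Suc floor_exp * (G * d))"
    using source_transfer[OF assms(1) linear_A TA _ floor_exp_def mu _ A_le lam_le D diff _ _ fin_lam source R]
      decay_const_ge_1 inv_sum_pos G d by simp
  also have "\<dots> \<le> decay_const * R * ((2 + G\<^sup>2) * source_rate + real floor_exp * D ^ Suc floor_exp * (G * source_rate))"
  proof -
    have "(2 + G\<^sup>2) * (1 / q) powr \<mu> \<le> (2 + G\<^sup>2) * source_rate" by (intro mult_left_mono) (auto simp: source_rate_def)
    moreover have "real floor_exp * D ^ Suc floor_exp * (G * d) \<le> real floor_exp * D ^ Suc floor_exp * (G * source_rate)"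
    proof (cases "floor_exp = 0")
      case False
      then have "min \<mu> 1 = 1" unfolding floor_exp_def by linarith
      then have "d \<le> source_rate" using d by (simp add: source_rate_def)
      then show ?thesis using G D by (intro mult_left_mono) auto
    qed simp
    ultimately show ?thesis using decay_const_ge_1 R by (intro mult_left_mono[OF add_mono]) auto
  qed
  also have "\<dots> = source_const * source_rate" by (simp add: source_const_def algebra_simps)
  finally show ?thesis .
qed

lemma damped_le_1: assumes "c \<in> S" shows "\<bar>damped c\<bar> \<le> 1"
proof -
  have "\<bar>damped c\<bar> \<le> exp (- (q * c) / 2)" by (rule damped_bound[OF S_nonneg[OF assms]])
  also have "\<dots> \<le> 1" using S_nonneg[OF assms] inv_sum_pos by simp
  finally show ?thesis .
qed

text \<open>The function \<open>q * c * damped c\<close> satisfies the decay condition of the source bound; its factor \<open>c\<close>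
is the operator \<open>A\<close> in \<open>r = A \<beta> + err\<close>.\<close>

lemma residual_bound: "norm (r - A b) \<le> 1 / q * (source_const * source_rate) + G * d"
proof -
  define f where "f c = q * c * damped c" for c
  have f: "fcalc f x = q *\<^sub>R fcalc damped (A x)" for x
    unfolding A_eq_fcalc fcalc_fcalc fcalc_scale[symmetric] by (rule fcalc_cong) (simp add: f_def)
  have "norm (fcalc f \<beta>) \<le> source_const * source_rate"
  proof (rule source_bound[OF linear_fcalc])
    fix j x assume j: "j \<le> Suc floor_exp"
    have "norm (fcalc f ((A ^^ j) x)) = norm (fcalc (\<lambda>c. f c * c ^ j) x)"
      by (simp add: funpow_eq_fcalc fcalc_fcalc)
    also have "\<dots> \<le> ((2 * real (Suc j)) ^ Suc j * (1 / q) ^ j) * norm x"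
    proof (rule norm_fcalc_le)
      fix c assume "c \<in> S"
      from power_damped_bound[OF S_nonneg[OF this], of j]
      show "\<bar>f c * c ^ j\<bar> \<le> (2 * real (Suc j)) ^ Suc j * (1 / q) ^ j" by (simp add: f_def mult_ac)
    qed (use inv_sum_pos in simp)
    also have "\<dots> \<le> decay_const * (1 / q) ^ j * norm x"
      using inv_sum_pos by (intro mult_right_mono decay_const_ge j) auto
    finally show "norm (fcalc f ((A ^^ j) x)) \<le> decay_const * (1 / q) ^ j * norm x" .
  qed
  then have "norm (fcalc damped (A \<beta>)) \<le> 1 / q * (source_const * source_rate)"
    using inv_sum_pos by (simp add: f field_simps)
  moreover have "norm (fcalc damped err) \<le> 1 * norm err"
    by (rule norm_fcalc_le) (use damped_le_1 in auto)
  moreover have "norm (r - A b) \<le> norm (fcalc damped r)"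
    using residual_norm_le_damped[OF res m card_roots roots_pos] by (simp add: roots_def)
  moreover have "fcalc damped r = fcalc damped (A \<beta>) + fcalc damped err"
    by (simp add: r linear_add[OF linear_fcalc])
  ultimately show ?thesis using err norm_triangle_ineq[of "fcalc damped (A \<beta>)" "fcalc damped err"] by simp
qed

lemma A_error_bound: "norm (A (b - \<beta>)) \<le> 1 / q * (source_const * source_rate) + 2 * G * d"
proof -
  have "A (b - \<beta>) = err - (r - A b)" by (simp add: linear_diff[OF linear_A] r)
  then show ?thesis using norm_triangle_ineq4[of err "r - A b"] residual_bound err by simp
qed

text \<open>The spectrum of \<open>A\<close> is cut at \<open>1/q\<close>, which is at most the smallest root of \<open>Q\<close>.  Below the cut \<open>Q\<close> lies
between 0 and 1, and \<open>(1 - Q(c)) / c\<close>, the polynomial applied to the noise, is at most \<open>q\<close>.  Above the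
cut \<open>1 \<le> q * c\<close>.\<close>

lemma error_bound: "norm (b - \<beta>) \<le> 2 * (source_const * source_rate) + 3 * G * (q * d)"
proof -
  obtain P where P: "b = poly_op P A r" "Q = 1 - pCons 0 P"
    using res by (auto simp: is_residual_poly_def)
  define lo :: "real \<Rightarrow> real" where "lo c = (if c \<le> 1 / q then 1 else 0)" for c
  define hi where "hi c = 1 - lo c" for c
  have Qlo: "0 \<le> poly Q c" "poly Q c \<le> 1" "1 - poly Q c \<le> q * c" if "0 \<le> c" "c \<le> 1 / q" for c
    using root_prod_bounds[of c] that inverse_inv_sum_le by (auto simp: poly_Q)
  have QP: "c * poly P c = 1 - poly Q c" for c by (simp add: P(2))
  have P_bound: "\<bar>poly P c\<bar> \<le> q" if "0 \<le> c" "c \<le> 1 / q" for c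
  proof (cases "c = 0")
    case True
    have "poly P 0 = q" using pderiv_Q unfolding P(2) by (simp add: pderiv_diff pderiv_pCons)
    then show ?thesis using True inv_sum_pos by simp
  next
    case False
    then have "0 \<le> c * poly P c" "c * poly P c \<le> c * q" "0 < c" using Qlo[OF that] QP[of c] that by (auto simp: mult.commute)
    then show ?thesis by (simp add: zero_le_mult_iff)
  qed
  have b_eq: "b = fcalc (\<lambda>c. poly P c * c) \<beta> + fcalc (poly P) err"
  proof -
    have "b = fcalc (poly P) r" unfolding P(1) poly_op_eq_fcalc ..
    also have "\<dots> = fcalc (\<lambda>c. poly P c * c) \<beta> + fcalc (poly P) err"
      by (simp add: r linear_add[OF linear_fcalc] A_eq_fcalc fcalc_fcalc)
    finally show ?thesis .
  qed
  have "\<beta> = fcalc (\<lambda>c. poly Q c + poly P c * c) \<beta>"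
    using fcalc_1[of \<beta>] by (simp add: P(2) mult.commute)
  then have "\<beta> - b = fcalc (poly Q) \<beta> - fcalc (poly P) err"
    unfolding fcalc_add b_eq by (simp add: algebra_simps)
  then have lo_eq: "fcalc lo (\<beta> - b) = fcalc (\<lambda>c. lo c * poly Q c) \<beta> - fcalc (\<lambda>c. lo c * poly P c) err"
    by (simp add: linear_diff[OF linear_fcalc] fcalc_fcalc)
  have "norm (fcalc (\<lambda>c. lo c * poly Q c) \<beta>) \<le> source_const * source_rate"
  proof (rule source_bound[OF linear_fcalc])
    fix j x
    have "norm (fcalc (\<lambda>c. lo c * poly Q c) ((A ^^ j) x)) = norm (fcalc (\<lambda>c. lo c * poly Q c * c ^ j) x)"
      by (simp add: funpow_eq_fcalc fcalc_fcalc)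
    also have "\<dots> \<le> (1 / q) ^ j * norm x"
    proof (rule norm_fcalc_le)
      fix c assume "c \<in> S"
      then have c: "0 \<le> c" by (rule S_nonneg)
      show "\<bar>lo c * poly Q c * c ^ j\<bar> \<le> (1 / q) ^ j"
      proof (cases "c \<le> 1 / q")
        case True
        have "poly Q c * c ^ j \<le> 1 * (1 / q) ^ j"
          using Qlo[OF c True] c True by (intro mult_mono power_mono) auto
        then show ?thesis using Qlo[OF c True] c True by (simp add: lo_def)
      qed (use inv_sum_pos in \<open>simp add: lo_def\<close>)
    qed (use inv_sum_pos in simp)
    also have "\<dots> \<le> decay_const * ((1 / q) ^ j * norm x)"
      using decay_const_ge_1 inv_sum_pos mult_right_mono[of 1 decay_const "(1 / q) ^ j * norm x"] by simp
    finally show "norm (fcalc (\<lambda>c. lo c * poly Q c) ((A ^^ j) x)) \<le> decay_const * (1 / q) ^ j * norm x"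
      by (simp add: mult.assoc)
  qed
  moreover have "norm (fcalc (\<lambda>c. lo c * poly P c) err) \<le> q * norm err"
    by (rule norm_fcalc_le) (use P_bound S_nonneg inv_sum_pos in \<open>auto simp: lo_def\<close>)
  moreover have "q * norm err \<le> q * (G * d)" using err inv_sum_pos by (intro mult_left_mono) auto
  ultimately have lo_bound: "norm (fcalc lo (\<beta> - b)) \<le> source_const * source_rate + q * (G * d)"
    unfolding lo_eq by (intro norm_triangle_le_diff) linarith
  have "norm (fcalc hi (\<beta> - b)) \<le> norm (fcalc (\<lambda>c. q * c) (\<beta> - b))"
  proof (rule norm_fcalc_mono)
    fix c assume "c \<in> S"
    then have "0 \<le> c" by (rule S_nonneg)
    then show "\<bar>hi c\<bar> \<le> \<bar>q * c\<bar>" using inv_sum_pos by (auto simp: hi_def lo_def field_simps)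
  qed
  also have "\<dots> = q * norm (A (b - \<beta>))"
    using inv_sum_pos unfolding fcalc_scale A_eq_fcalc[symmetric]
    by (simp add: linear_diff[OF linear_A] norm_minus_commute)
  also have "\<dots> \<le> q * (1 / q * (source_const * source_rate) + 2 * G * d)"
    using A_error_bound inv_sum_pos by (intro mult_left_mono) auto
  also have "\<dots> = source_const * source_rate + 2 * G * (q * d)" using inv_sum_pos by (simp add: field_simps)
  finally have hi_bound: "norm (fcalc hi (\<beta> - b)) \<le> source_const * source_rate + 2 * G * (q * d)" .
  have "\<beta> - b = fcalc (\<lambda>c. lo c + hi c) (\<beta> - b)" by (simp add: hi_def fcalc_1)
  then have "norm (\<beta> - b) \<le> norm (fcalc lo (\<beta> - b)) + norm (fcalc hi (\<beta> - b))"
    unfolding fcalc_add by (metis norm_triangle_ineq)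
  then show ?thesis using lo_bound hi_bound by (simp add: norm_minus_commute algebra_simps)
qed

text \<open>Passing from \<open>A e\<close> to \<open>K e\<close> adds \<open>G * d * \<parallel>e\<parallel>\<close>, and this is absorbed because \<open>q * d\<close> is bounded.\<close>

lemma K_error_bound: "q * norm (K (b - \<beta>)) \<le> (1 + 2 * G\<^sup>2) * (source_const * source_rate) + (2 * G + 3 * G ^ 3) * (q * d)"
proof -
  have qd: "q * d \<le> G" using slope inv_sum_pos by (simp add: pderiv_Q)
  have "norm (K (b - \<beta>)) \<le> norm (K (b - \<beta>) - A (b - \<beta>)) + norm (A (b - \<beta>))"
    using norm_triangle_ineq[of "K (b - \<beta>) - A (b - \<beta>)" "A (b - \<beta>)"] by simp
  then have "norm (K (b - \<beta>)) \<le> G * d * norm (b - \<beta>) + (1 / q * (source_const * source_rate) + 2 * G * d)"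
    using diff[of "b - \<beta>"] A_error_bound by linarith
  then have "q * norm (K (b - \<beta>)) \<le> q * (G * d * norm (b - \<beta>) + (1 / q * (source_const * source_rate) + 2 * G * d))"
    using inv_sum_pos by (intro mult_left_mono) auto
  also have "\<dots> = G * (q * d) * norm (b - \<beta>) + source_const * source_rate + 2 * G * (q * d)"
    using inv_sum_pos by (simp add: field_simps)
  also have "G * (q * d) * norm (b - \<beta>) \<le> G * G * (2 * (source_const * source_rate) + 3 * G * (q * d))"
    using qd G error_bound by (intro mult_mono mult_left_mono) auto
  finally show ?thesis by (simp add: power2_eq_square power3_eq_cube algebra_simps)
qed

theorem pls_error_bound:
  assumes s: "0 \<le> s" "s \<le> 1" and q_def: "qq = \<bar>poly (pderiv Q) 0\<bar>"
  shows "(norm (op_powr J lam v s (b - \<beta>)))\<^sup>2 \<le> pls_const \<mu> R D G *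
    (qq powr (2 * (1 - s)) * d\<^sup>2 + qq powr (- 2 * (\<mu> + s)) + qq powr (- 2 * s) * d powr (2 * min \<mu> 1))"
proof -
  have q0: "0 < q" by (rule inv_sum_pos)
  have qq: "qq = q" using q0 by (simp add: q_def pderiv_Q)
  define N where "N = (2 + 2 * G\<^sup>2) * source_const + 5 * G + 3 * G ^ 3"
  have G3: "0 \<le> G ^ 3" "0 \<le> G\<^sup>2" "0 \<le> G\<^sup>2 * source_const" using G source_const_nonneg by auto
  have le: "norm (b - \<beta>) \<le> N * (source_rate + q * d)"
  proof -
    have "2 * source_const \<le> N" "3 * G \<le> N" "0 \<le> N" using G3 G source_const_nonneg by (auto simp: N_def algebra_simps)
    then have "2 * source_const * source_rate + 3 * G * (q * d) \<le> N * source_rate + N * (q * d)"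
      using source_rate_nonneg q0 d by (intro add_mono mult_right_mono) auto
    then show ?thesis using error_bound by (simp add: algebra_simps)
  qed
  have leK: "q * norm (K (b - \<beta>)) \<le> N * (source_rate + q * d)"
  proof -
    have "(1 + 2 * G\<^sup>2) * source_const \<le> N" "2 * G + 3 * G ^ 3 \<le> N" using G3 G source_const_nonneg by (auto simp: N_def algebra_simps)
    then have "(1 + 2 * G\<^sup>2) * source_const * source_rate + (2 * G + 3 * G ^ 3) * (q * d) \<le> N * source_rate + N * (q * d)"
      using source_rate_nonneg q0 d by (intro add_mono mult_right_mono) auto
    then show ?thesis using K_error_bound by (simp add: algebra_simps)
  qed
  have "(norm (op_powr J lam v s (b - \<beta>)))\<^sup>2 \<le> q powr (- 2 * s) * ((norm (b - \<beta>))\<^sup>2 + q\<^sup>2 * (norm (K (b - \<beta>)))\<^sup>2)"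
    by (rule op_powr_interpolation[OF s q0])
  also have "(norm (b - \<beta>))\<^sup>2 + q\<^sup>2 * (norm (K (b - \<beta>)))\<^sup>2 \<le> (N * (source_rate + q * d))\<^sup>2 + (N * (source_rate + q * d))\<^sup>2"
    unfolding power_mult_distrib[symmetric] using le leK q0 by (intro add_mono power_mono) auto
  also have "\<dots> = 2 * N\<^sup>2 * ((1 / q) powr \<mu> + d powr (min \<mu> 1) + q * d)\<^sup>2"
    by (simp add: power_mult_distrib source_rate_def)
  also have "\<dots> \<le> 2 * N\<^sup>2 * (3 * (((1 / q) powr \<mu>)\<^sup>2 + (d powr (min \<mu> 1))\<^sup>2 + (q * d)\<^sup>2))"
    by (intro mult_left_mono three_term_square) simp
  also have "\<dots> = 6 * N\<^sup>2 * (((1 / q) powr \<mu>)\<^sup>2 + (d powr (min \<mu> 1))\<^sup>2 + (q * d)\<^sup>2)" by simp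
  finally have "(norm (op_powr J lam v s (b - \<beta>)))\<^sup>2 \<le>
    q powr (- 2 * s) * (6 * N\<^sup>2 * (((1 / q) powr \<mu>)\<^sup>2 + (d powr (min \<mu> 1))\<^sup>2 + (q * d)\<^sup>2))"
    by (simp add: mult_left_mono)
  also have "\<dots> = 6 * N\<^sup>2 * (q powr (- 2 * s) * (q * d)\<^sup>2 + q powr (- 2 * s) * ((1 / q) powr \<mu>)\<^sup>2
      + q powr (- 2 * s) * (d powr (min \<mu> 1))\<^sup>2)"
    by (simp add: algebra_simps)
  also have "q powr (- 2 * s) * (q * d)\<^sup>2 = q powr (2 * (1 - s)) * d\<^sup>2"
  proof -
    have "q powr (- 2 * s) * q\<^sup>2 = q powr (- 2 * s) * q powr 2" using q0 by simp
    also have "\<dots> = q powr (2 * (1 - s))" unfolding powr_add[symmetric] by (simp add: algebra_simps)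
    finally show ?thesis by (simp add: power_mult_distrib flip: mult.assoc)
  qed
  also have "q powr (- 2 * s) * ((1 / q) powr \<mu>)\<^sup>2 = q powr (- 2 * (\<mu> + s))"
  proof -
    have "((1 / q) powr \<mu>)\<^sup>2 = q powr (- 2 * \<mu>)"
      using q0 by (simp add: powr_divide powr_minus_divide power2_eq_square powr_add[symmetric])
    then show ?thesis by (simp add: powr_add[symmetric] algebra_simps)
  qed
  also have "(d powr (min \<mu> 1))\<^sup>2 = d powr (2 * min \<mu> 1)"
    by (simp add: power2_eq_square powr_add[symmetric])
  finally show ?thesis unfolding qq pls_const_def N_def source_const_def decay_const_def floor_exp_def Let_def .
qed

end

section \<open>Variance of sample means in a Hilbert space\<close>

context prob_space
begin

text \<open>Independence removes the mixed terms of the square.  The statement is in terms of nonnegative integrals,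
so an infinite second moment is allowed.\<close>

lemma sample_mean_variance:
  fixes W :: "nat \<Rightarrow> 'a \<Rightarrow> 'b" and g :: "'b \<Rightarrow> real"
  assumes indep: "indep_vars (\<lambda>_. N) W {1..}" and W0: "W0 \<in> measurable M N"
    and dist: "\<And>i. 1 \<le> i \<Longrightarrow> distr M N (W i) = distr M N W0"
    and g: "g \<in> borel_measurable N" and c: "has_bochner_integral M (\<lambda>\<omega>. g (W0 \<omega>)) c"
    and n: "1 \<le> n"
  shows "(\<integral>\<^sup>+\<omega>. ennreal (((1 / real n) * (\<Sum>i=1..n. g (W i \<omega>)) - c)\<^sup>2) \<partial>M)
    \<le> ennreal (1 / real n) * (\<integral>\<^sup>+\<omega>. ennreal ((g (W0 \<omega>))\<^sup>2) \<partial>M)"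
proof (cases "(\<integral>\<^sup>+\<omega>. ennreal ((g (W0 \<omega>))\<^sup>2) \<partial>M) = \<infinity>")
  case True
  then show ?thesis using n by (simp add: ennreal_mult_top)
next
  case False
  note [measurable] = W0 g
  have Wm[measurable]: "W i \<in> measurable M N" if "1 \<le> i" for i
    using indep that by (auto simp: indep_vars_def2)
  define f where "f i \<omega> = g (W i \<omega>) - c" for i \<omega>
  define V where "V = (\<integral>\<omega>. (g (W0 \<omega>) - c)\<^sup>2 \<partial>M)"
  have gint: "integrable M (\<lambda>\<omega>. g (W0 \<omega>))" "(\<integral>\<omega>. g (W0 \<omega>) \<partial>M) = c"
    using c by (auto simp: has_bochner_integral_iff)
  have g2: "integrable M (\<lambda>\<omega>. (g (W0 \<omega>))\<^sup>2)"
    by (rule integrableI_bounded) (use False in \<open>auto simp: less_top\<close>)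
  have f2: "integrable M (\<lambda>\<omega>. (g (W0 \<omega>) - c)\<^sup>2)"
    unfolding power2_diff using gint(1) g2 by (intro Bochner_Integration.integrable_add Bochner_Integration.integrable_diff) auto
  have transfer: "integrable M (\<lambda>\<omega>. h (W i \<omega>)) \<longleftrightarrow> integrable M (\<lambda>\<omega>. h (W0 \<omega>))"
      "(\<integral>\<omega>. h (W i \<omega>) \<partial>M) = (\<integral>\<omega>. h (W0 \<omega>) \<partial>M)"
    if i: "1 \<le> i" and h[measurable]: "h \<in> borel_measurable N" for i and h :: "'b \<Rightarrow> real"
    using i integrable_distr_eq[of "W i" M N h] integrable_distr_eq[of W0 M N h]
      integral_distr[of "W i" M N h] integral_distr[of W0 M N h] dist[OF i] by simp_all
  have fint: "integrable M (f i)" "(\<integral>\<omega>. f i \<omega> \<partial>M) = 0" if "1 \<le> i" for i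
    using transfer[OF that, of "\<lambda>x. g x - c"] gint by (simp_all add: f_def[abs_def] prob_space)
  have f2int: "integrable M (\<lambda>\<omega>. f i \<omega> * f i \<omega>)" "(\<integral>\<omega>. f i \<omega> * f i \<omega> \<partial>M) = V" if "1 \<le> i" for i
    using transfer[OF that, of "\<lambda>x. (g x - c)\<^sup>2"] f2 by (simp_all add: f_def[abs_def] V_def power2_eq_square)
  have cross: "integrable M (\<lambda>\<omega>. f i \<omega> * f j \<omega>)" "(\<integral>\<omega>. f i \<omega> * f j \<omega> \<partial>M) = 0"
    if "1 \<le> i" "1 \<le> j" "i \<noteq> j" for i j
  proof -
    have "indep_vars (\<lambda>_. N) W {i, j}" by (rule indep_vars_subset[OF indep]) (use that in auto)
    then have ind: "indep_vars (\<lambda>_. borel) f {i, j}"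
      using indep_vars_compose2[of "\<lambda>_. N" W "{i, j}" "\<lambda>_ x. g x - c" "\<lambda>_. borel"]
      by (simp add: f_def[abs_def])
    show "integrable M (\<lambda>\<omega>. f i \<omega> * f j \<omega>)" "(\<integral>\<omega>. f i \<omega> * f j \<omega> \<partial>M) = 0"
      using indep_vars_integrable[OF _ ind] indep_vars_lebesgue_integral[OF _ ind] that fint by auto
  qed
  have ff: "integrable M (\<lambda>\<omega>. f i \<omega> * f j \<omega>)" if "i \<in> {1..n}" "j \<in> {1..n}" for i j
    using cross[of i j] f2int[of i] that by (cases "i = j") auto
  have sq: "(\<Sum>i=1..n. f i \<omega>)\<^sup>2 = (\<Sum>i=1..n. \<Sum>j=1..n. f i \<omega> * f j \<omega>)" for \<omega>
    by (simp add: power2_eq_square sum_product)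
  have sqint: "integrable M (\<lambda>\<omega>. (\<Sum>i=1..n. f i \<omega>)\<^sup>2)"
    unfolding sq by (intro Bochner_Integration.integrable_sum ff)
  have "(\<integral>\<omega>. (\<Sum>i=1..n. f i \<omega>)\<^sup>2 \<partial>M) = (\<Sum>i=1..n. \<Sum>j=1..n. (\<integral>\<omega>. f i \<omega> * f j \<omega> \<partial>M))"
  proof -
    have "(\<integral>\<omega>. (\<Sum>i=1..n. f i \<omega>)\<^sup>2 \<partial>M) = (\<Sum>i=1..n. \<integral>\<omega>. (\<Sum>j=1..n. f i \<omega> * f j \<omega>) \<partial>M)"
      unfolding sq by (intro Bochner_Integration.integral_sum Bochner_Integration.integrable_sum ff)
    also have "\<dots> = (\<Sum>i=1..n. \<Sum>j=1..n. (\<integral>\<omega>. f i \<omega> * f j \<omega> \<partial>M))"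
      by (intro sum.cong refl Bochner_Integration.integral_sum ff)
    finally show ?thesis .
  qed
  also have "\<dots> = (\<Sum>i=1..n. \<Sum>j=1..n. if j = i then V else 0)"
    by (intro sum.cong refl) (use cross f2int in auto)
  also have "\<dots> = real n * V" by simp
  finally have var: "(\<integral>\<omega>. (\<Sum>i=1..n. f i \<omega>)\<^sup>2 \<partial>M) = real n * V" .
  have mean: "(1 / real n) * (\<Sum>i=1..n. g (W i \<omega>)) - c = (1 / real n) * (\<Sum>i=1..n. f i \<omega>)" for \<omega>
    using n by (simp add: f_def sum_subtractf field_simps)
  have "V \<le> (\<integral>\<omega>. (g (W0 \<omega>))\<^sup>2 \<partial>M)"
  proof -
    have "V = (\<integral>\<omega>. ((g (W0 \<omega>))\<^sup>2 + c\<^sup>2) - 2 * g (W0 \<omega>) * c \<partial>M)" by (simp add: V_def power2_diff)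
    also have "\<dots> = (\<integral>\<omega>. (g (W0 \<omega>))\<^sup>2 \<partial>M) + c\<^sup>2 - 2 * c * c"
      using gint g2 by (simp add: prob_space)
    finally show ?thesis by (simp add: power2_eq_square)
  qed
  then have Vle: "real n * V / (real n)\<^sup>2 \<le> 1 / real n * (\<integral>\<omega>. (g (W0 \<omega>))\<^sup>2 \<partial>M)"
    using n by (simp add: power2_eq_square divide_right_mono)
  have "(\<integral>\<^sup>+\<omega>. ennreal (((1 / real n) * (\<Sum>i=1..n. g (W i \<omega>)) - c)\<^sup>2) \<partial>M)
      = (\<integral>\<^sup>+\<omega>. ennreal ((\<Sum>i=1..n. f i \<omega>)\<^sup>2 / (real n)\<^sup>2) \<partial>M)"
    unfolding mean by (simp add: power_divide)
  also have "\<dots> = ennreal (\<integral>\<omega>. (\<Sum>i=1..n. f i \<omega>)\<^sup>2 / (real n)\<^sup>2 \<partial>M)"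
    by (rule nn_integral_eq_integral) (use sqint in auto)
  also have "\<dots> = ennreal (real n * V / (real n)\<^sup>2)" by (simp only: integral_divide_zero var)
  also have "\<dots> \<le> ennreal (1 / real n * (\<integral>\<omega>. (g (W0 \<omega>))\<^sup>2 \<partial>M))" by (rule ennreal_leI[OF Vle])
  also have "\<dots> = ennreal (1 / real n) * ennreal (\<integral>\<omega>. (g (W0 \<omega>))\<^sup>2 \<partial>M)" by (rule ennreal_mult) auto
  also have "ennreal (\<integral>\<omega>. (g (W0 \<omega>))\<^sup>2 \<partial>M) = (\<integral>\<^sup>+\<omega>. ennreal ((g (W0 \<omega>))\<^sup>2) \<partial>M)"
    by (rule nn_integral_eq_integral[symmetric]) (use g2 in auto)
  finally show ?thesis .
qed

text \<open>The threshold \<open>t\<close> must not depend on \<open>n\<close>; this is what makes the events usable for \<open>O_P\<close>.\<close>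

lemma markov_rate:
  assumes "\<And>n. 1 \<le> n \<Longrightarrow> H n \<in> borel_measurable M"
    and "\<And>n. 1 \<le> n \<Longrightarrow> (\<integral>\<^sup>+\<omega>. H n \<omega> \<partial>M) \<le> ennreal (1 / real n) * ennreal C"
    and "0 < \<epsilon>"
  obtains t where "0 < t"
    "\<And>n. 1 \<le> n \<Longrightarrow> \<exists>E\<in>sets M. measure M E \<le> \<epsilon> \<and> (\<forall>\<omega>\<in>space M - E. H n \<omega> \<le> ennreal (t / real n))"
proof
  define C' where "C' = max C 0"
  define t where "t = C' / \<epsilon> + 1"
  show t: "0 < t" using assms(3) by (simp add: t_def C'_def add_nonneg_pos)
  fix n :: nat assume n: "1 \<le> n"
  note [measurable] = assms(1)[OF n]
  define E where "E = {\<omega> \<in> space M. 1 \<le> ennreal (real n / t) * H n \<omega>}"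
  have E: "E \<in> sets M" unfolding E_def by measurable
  have "emeasure M E \<le> ennreal (real n / t) * (\<integral>\<^sup>+\<omega>. H n \<omega> * indicator (space M) \<omega> \<partial>M)"
    unfolding E_def by (rule nn_integral_Markov_inequality) auto
  also have "(\<integral>\<^sup>+\<omega>. H n \<omega> * indicator (space M) \<omega> \<partial>M) = (\<integral>\<^sup>+\<omega>. H n \<omega> \<partial>M)"
    by (rule nn_integral_cong) auto
  also have "ennreal (real n / t) * (\<integral>\<^sup>+\<omega>. H n \<omega> \<partial>M) \<le> ennreal (real n / t) * (ennreal (1 / real n) * ennreal C')"
  proof (rule mult_left_mono)
    have "(\<integral>\<^sup>+\<omega>. H n \<omega> \<partial>M) \<le> ennreal (1 / real n) * ennreal C" by (rule assms(2)[OF n])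
    also have "\<dots> \<le> ennreal (1 / real n) * ennreal C'"
      by (intro mult_left_mono ennreal_leI) (auto simp: C'_def)
    finally show "(\<integral>\<^sup>+\<omega>. H n \<omega> \<partial>M) \<le> ennreal (1 / real n) * ennreal C'" .
  qed simp
  also have "\<dots> = ennreal (real n / t * (1 / real n * C'))"
    using t by (subst ennreal_mult[symmetric], auto simp: C'_def)+
  also have "\<dots> \<le> ennreal \<epsilon>"
  proof (rule ennreal_leI)
    have "C' / t \<le> \<epsilon>" using assms(3) t by (simp add: pos_divide_le_eq) (simp add: t_def distrib_left)
    then show "real n / t * (1 / real n * C') \<le> \<epsilon>" using n by simp
  qed
  finally have mE: "measure M E \<le> \<epsilon>"
    using assms(3) by (simp add: measure_def enn2real_leI)
  have "H n \<omega> \<le> ennreal (t / real n)" if "\<omega> \<in> space M - E" for \<omega>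
  proof -
    have "ennreal (real n / t) * H n \<omega> \<le> 1" using that by (auto simp: E_def not_le)
    then have "ennreal (t / real n) * (ennreal (real n / t) * H n \<omega>) \<le> ennreal (t / real n) * 1"
      by (rule mult_left_mono) simp
    moreover have "ennreal (t / real n) * (ennreal (real n / t) * H n \<omega>) = H n \<omega>"
      using t n by (simp add: mult.assoc[symmetric] ennreal_mult[symmetric])
    ultimately show ?thesis by simp
  qed
  then show "\<exists>E\<in>sets M. measure M E \<le> \<epsilon> \<and> (\<forall>\<omega>\<in>space M - E. H n \<omega> \<le> ennreal (t / real n))"
    using E mE by blast
qed

text \<open>The tower property: \<open>f (X \<omega>)\<close> is measurable with respect to the \<open>\<sigma>\<close>-algebra generated by \<open>X\<close>.\<close>

lemma conditional_second_moment:
  fixes X :: "'a \<Rightarrow> 'b::topological_space"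
  assumes X: "X \<in> borel_measurable M" and e[measurable]: "e \<in> borel_measurable M" and f[measurable]: "f \<in> borel_measurable borel"
    and cond: "AE \<omega> in M. nn_cond_exp M (vimage_algebra (space M) X borel) e \<omega> \<le> c"
  shows "(\<integral>\<^sup>+\<omega>. f (X \<omega>) * e \<omega> \<partial>M) \<le> c * (\<integral>\<^sup>+\<omega>. f (X \<omega>) \<partial>M)"
proof -
  let ?F = "vimage_algebra (space M) X borel"
  note [measurable] = X
  have sub: "subalgebra M ?F"
    unfolding subalgebra_def using measurable_sets[OF X]
    by (auto simp: sets_vimage_algebra2)
  then have "finite_measure_subalgebra M ?F" by unfold_locales
  then interpret sigma_finite_subalgebra M ?F by (rule finite_measure_subalgebra_is_sigma_finite)
  have "X \<in> measurable ?F borel" by (rule measurable_vimage_algebra1) simp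
  then have fX: "(\<lambda>\<omega>. f (X \<omega>)) \<in> borel_measurable ?F" by measurable
  have "(\<integral>\<^sup>+\<omega>. f (X \<omega>) * e \<omega> \<partial>M) = (\<integral>\<^sup>+\<omega>. f (X \<omega>) * nn_cond_exp M ?F e \<omega> \<partial>M)"
    by (rule nn_cond_exp_intg[OF fX e, symmetric])
  also have "\<dots> \<le> (\<integral>\<^sup>+\<omega>. c * f (X \<omega>) \<partial>M)"
  proof (rule nn_integral_mono_AE, rule AE_mp[OF cond], intro AE_I2 impI)
    fix \<omega> assume "nn_cond_exp M ?F e \<omega> \<le> c"
    then have "f (X \<omega>) * nn_cond_exp M ?F e \<omega> \<le> f (X \<omega>) * c" by (rule mult_left_mono) simp
    then show "f (X \<omega>) * nn_cond_exp M ?F e \<omega> \<le> c * f (X \<omega>)" by (simp only: mult.commute[of c])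
  qed
  also have "\<dots> = c * (\<integral>\<^sup>+\<omega>. f (X \<omega>) \<partial>M)" by (rule nn_integral_cmult) simp
  finally show ?thesis .
qed

end

lemma (in eigenbasis) ennreal_parseval:
  "ennreal ((norm x)\<^sup>2) = (\<Sum>j. ennreal (if j \<in> J then (v j \<bullet> x)\<^sup>2 else 0))"
  using parseval[of x] by (subst suminf_ennreal_eq) auto

text \<open>An orthonormal eigenbasis of some operator turns the squared norm into a series of squared coordinates,
and the real-valued estimate applies to each of them.\<close>

lemma sample_mean_variance_vector:
  fixes W :: "nat \<Rightarrow> 'w \<Rightarrow> 'b" and g :: "'b \<Rightarrow> 'h::{real_inner,banach,second_countable_topology}"
  assumes M: "prob_space M" and basis: "eigenbasis K J lam (v :: nat \<Rightarrow> 'h)"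
    and indep: "prob_space.indep_vars M (\<lambda>_. N) W {1..}" and W0: "W0 \<in> measurable M N"
    and dist: "\<And>i. 1 \<le> i \<Longrightarrow> distr M N (W i) = distr M N W0"
    and g: "g \<in> borel_measurable N" and c: "has_bochner_integral M (\<lambda>\<omega>. g (W0 \<omega>)) c"
    and n: "1 \<le> n"
  shows "(\<integral>\<^sup>+\<omega>. ennreal ((norm ((1 / real n) *\<^sub>R (\<Sum>i=1..n. g (W i \<omega>)) - c))\<^sup>2) \<partial>M)
    \<le> ennreal (1 / real n) * (\<integral>\<^sup>+\<omega>. ennreal ((norm (g (W0 \<omega>)))\<^sup>2) \<partial>M)"
proof -
  interpret prob_space M by fact
  interpret eigenbasis K J lam v by fact
  note [measurable] = W0 g
  have Wm[measurable]: "W i \<in> measurable M N" if "1 \<le> i" for i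
    using indep that by (auto simp: indep_vars_def2)
  have [measurable]: "(\<lambda>\<omega>. \<Sum>i=1..n. g (W i \<omega>)) \<in> borel_measurable M"
    by (rule borel_measurable_sum) simp
  let ?d = "\<lambda>\<omega>. (1 / real n) *\<^sub>R (\<Sum>i=1..n. g (W i \<omega>)) - c"
  have "(\<integral>\<^sup>+\<omega>. ennreal ((norm (?d \<omega>))\<^sup>2) \<partial>M)
      = (\<Sum>j. \<integral>\<^sup>+\<omega>. ennreal (if j \<in> J then (v j \<bullet> ?d \<omega>)\<^sup>2 else 0) \<partial>M)"
    unfolding ennreal_parseval by (rule nn_integral_suminf) measurable
  also have "\<dots> \<le> (\<Sum>j. ennreal (1 / real n) * (\<integral>\<^sup>+\<omega>. ennreal (if j \<in> J then (v j \<bullet> g (W0 \<omega>))\<^sup>2 else 0) \<partial>M))"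
  proof (rule suminf_le)
    fix j
    have cj: "has_bochner_integral M (\<lambda>\<omega>. v j \<bullet> g (W0 \<omega>)) (v j \<bullet> c)"
      by (rule has_bochner_integral_inner_right) (use c in simp)
    have vd: "v j \<bullet> ?d \<omega> = (1 / real n) * (\<Sum>i=1..n. v j \<bullet> g (W i \<omega>)) - v j \<bullet> c" for \<omega>
      by (simp add: inner_diff_right inner_sum_right)
    have "(\<integral>\<^sup>+\<omega>. ennreal ((v j \<bullet> ?d \<omega>)\<^sup>2) \<partial>M) \<le> ennreal (1 / real n) * (\<integral>\<^sup>+\<omega>. ennreal ((v j \<bullet> g (W0 \<omega>))\<^sup>2) \<partial>M)"
      unfolding vd by (rule sample_mean_variance[OF indep W0 dist _ cj n]) auto
    then show "(\<integral>\<^sup>+\<omega>. ennreal (if j \<in> J then (v j \<bullet> ?d \<omega>)\<^sup>2 else 0) \<partial>M)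
       \<le> ennreal (1 / real n) * (\<integral>\<^sup>+\<omega>. ennreal (if j \<in> J then (v j \<bullet> g (W0 \<omega>))\<^sup>2 else 0) \<partial>M)"
      by (cases "j \<in> J") (simp_all only: if_True if_False, simp)
  qed auto
  also have "\<dots> = ennreal (1 / real n) * (\<Sum>j. \<integral>\<^sup>+\<omega>. ennreal (if j \<in> J then (v j \<bullet> g (W0 \<omega>))\<^sup>2 else 0) \<partial>M)"
    by (rule ennreal_suminf_cmult)
  also have "(\<Sum>j. \<integral>\<^sup>+\<omega>. ennreal (if j \<in> J then (v j \<bullet> g (W0 \<omega>))\<^sup>2 else 0) \<partial>M)
      = (\<integral>\<^sup>+\<omega>. ennreal ((norm (g (W0 \<omega>)))\<^sup>2) \<partial>M)"
    unfolding ennreal_parseval by (rule nn_integral_suminf[symmetric]) measurable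
  finally show ?thesis .
qed

section \<open>Sample covariance and sample noise\<close>

lemma K_hat_spectral_resolution:
  obtains S E where "spectral_resolution (K_hat Xs n \<omega> :: 'h::real_inner \<Rightarrow> 'h) S E"
proof (rule finite_rank_spectral_resolution)
  show "linear (K_hat Xs n \<omega>)"
    by (rule linearI) (simp_all add: K_hat_def tensor_sq_def inner_add_right scaleR_add_left sum.distrib
        scaleR_add_right scaleR_sum_right mult_ac)
  show "K_hat Xs n \<omega> x \<bullet> y = x \<bullet> K_hat Xs n \<omega> y" for x y
    by (simp add: K_hat_def tensor_sq_def inner_sum_left inner_sum_right inner_commute mult_ac)
  show "0 \<le> K_hat Xs n \<omega> x \<bullet> x" for x
    by (auto simp: K_hat_def tensor_sq_def inner_sum_left intro!: sum_nonneg divide_nonneg_nonneg)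
  show "finite ((\<lambda>i. Xs i \<omega>) ` {1..n})" by simp
  show "K_hat Xs n \<omega> x \<in> span ((\<lambda>i. Xs i \<omega>) ` {1..n})" for x
    unfolding K_hat_def tensor_sq_def by (intro span_scale span_sum span_base) auto
qed (rule that)

lemma r_hat_eq:
  "r_hat Xs Ys n \<omega> = K_hat Xs n \<omega> \<beta> + (1 / real n) *\<^sub>R (\<Sum>i=1..n. (Ys i \<omega> - \<beta> \<bullet> Xs i \<omega>) *\<^sub>R Xs i \<omega>)"
  unfolding r_hat_def K_hat_def tensor_sq_def scaleR_add_right[symmetric] sum.distrib[symmetric]
  by (intro arg_cong2[where f = scaleR] refl sum.cong) (simp add: scaleR_diff_left inner_commute)

context prob_space
begin

lemma integrable_norm_square:
  fixes X :: "'a \<Rightarrow> 'h::{real_inner, banach, second_countable_topology}"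
  assumes [measurable]: "X \<in> borel_measurable M" and "integrable M (\<lambda>\<omega>. norm (X \<omega>) ^ 4)"
  shows "integrable M (\<lambda>\<omega>. (norm (X \<omega>))\<^sup>2)"
  by (rule square_integrable_imp_integrable) (use assms(2) in \<open>simp_all flip: power_mult\<close>)

lemma has_integral_covariance_op:
  fixes X :: "'a \<Rightarrow> 'h::{real_inner, banach, second_countable_topology}"
  assumes [measurable]: "X \<in> borel_measurable M" and "integrable M (\<lambda>\<omega>. norm (X \<omega>) ^ 4)"
  shows "has_bochner_integral M (\<lambda>\<omega>. tensor_sq (X \<omega>) b) (covariance_op M X b)"
proof -
  have "integrable M (\<lambda>\<omega>. (norm (X \<omega>))\<^sup>2 * norm b)"
    using integrable_norm_square[OF assms] by simp
  then have "integrable M (\<lambda>\<omega>. tensor_sq (X \<omega>) b)"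
  proof (rule Bochner_Integration.integrable_bound)
    show "(\<lambda>\<omega>. tensor_sq (X \<omega>) b) \<in> borel_measurable M" unfolding tensor_sq_def by measurable
    have "norm (tensor_sq (X \<omega>) b) \<le> (norm (X \<omega>))\<^sup>2 * norm b" for \<omega>
      using mult_right_mono[OF Cauchy_Schwarz_ineq2[of "X \<omega>" b] norm_ge_zero[of "X \<omega>"]]
      by (simp add: tensor_sq_def power2_eq_square mult_ac)
    then show "AE \<omega> in M. norm (tensor_sq (X \<omega>) b) \<le> norm ((norm (X \<omega>))\<^sup>2 * norm b)" by simp
  qed
  then show ?thesis unfolding covariance_op_def by (rule has_bochner_integral_integrable)
qed

text \<open>The series is the squared Hilbert-Schmidt norm of \<open>A - K\<close>.  Each term is the variance of a sample mean,
and by Parseval the second moments \<open>(v j \<bullet> X)\<^sup>2 \<parallel>X\<parallel>\<^sup>2\<close> add up to \<open>\<parallel>X\<parallel>\<^sup>4\<close>.\<close>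

lemma K_hat_hilbert_schmidt_variance:
  fixes X :: "'a \<Rightarrow> 'h::{real_inner, banach, second_countable_topology}"
  assumes basis: "eigenbasis (covariance_op M X) J lam v"
    and X: "X \<in> borel_measurable M" and X4: "integrable M (\<lambda>\<omega>. norm (X \<omega>) ^ 4)"
    and indep: "indep_vars (\<lambda>_. borel) Xs {1..}"
    and dist: "\<And>i. 1 \<le> i \<Longrightarrow> distr M borel (Xs i) = distr M borel X"
    and n: "1 \<le> n"
  shows "(\<lambda>\<omega>. \<Sum>j. ennreal (if j \<in> J then (norm (K_hat Xs n \<omega> (v j) - covariance_op M X (v j)))\<^sup>2 else 0)) \<in> borel_measurable M"
    and "(\<integral>\<^sup>+\<omega>. (\<Sum>j. ennreal (if j \<in> J then (norm (K_hat Xs n \<omega> (v j) - covariance_op M X (v j)))\<^sup>2 else 0)) \<partial>M)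
      \<le> ennreal (1 / real n) * ennreal (\<integral>\<omega>. norm (X \<omega>) ^ 4 \<partial>M)"
proof -
  interpret eigenbasis "covariance_op M X" J lam v by fact
  note [measurable] = X
  have Xsm[measurable]: "Xs i \<in> borel_measurable M" if "1 \<le> i" for i
    using indep that by (auto simp: indep_vars_def2)
  have Km[measurable]: "(\<lambda>\<omega>. K_hat Xs n \<omega> b) \<in> borel_measurable M" for b
  proof -
    have "(\<lambda>\<omega>. \<Sum>i=1..n. tensor_sq (Xs i \<omega>) b) \<in> borel_measurable M"
      unfolding tensor_sq_def by (rule borel_measurable_sum) simp
    then show ?thesis unfolding K_hat_def by simp
  qed
  show "(\<lambda>\<omega>. \<Sum>j. ennreal (if j \<in> J then (norm (K_hat Xs n \<omega> (v j) - covariance_op M X (v j)))\<^sup>2 else 0)) \<in> borel_measurable M"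
    by measurable
  have tm: "(\<lambda>x. tensor_sq x b) \<in> borel_measurable borel" for b :: 'h
    unfolding tensor_sq_def by measurable
  have "(\<integral>\<^sup>+\<omega>. (\<Sum>j. ennreal (if j \<in> J then (norm (K_hat Xs n \<omega> (v j) - covariance_op M X (v j)))\<^sup>2 else 0)) \<partial>M)
    = (\<Sum>j. \<integral>\<^sup>+\<omega>. ennreal (if j \<in> J then (norm (K_hat Xs n \<omega> (v j) - covariance_op M X (v j)))\<^sup>2 else 0) \<partial>M)"
    by (rule nn_integral_suminf) measurable
  also have "\<dots> \<le> (\<Sum>j. ennreal (1 / real n) * (\<integral>\<^sup>+\<omega>. ennreal (if j \<in> J then (norm (tensor_sq (X \<omega>) (v j)))\<^sup>2 else 0) \<partial>M))"
  proof (rule suminf_le)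
    fix j
    have "(\<integral>\<^sup>+\<omega>. ennreal ((norm (K_hat Xs n \<omega> (v j) - covariance_op M X (v j)))\<^sup>2) \<partial>M)
        \<le> ennreal (1 / real n) * (\<integral>\<^sup>+\<omega>. ennreal ((norm (tensor_sq (X \<omega>) (v j)))\<^sup>2) \<partial>M)"
      unfolding K_hat_def
      by (rule sample_mean_variance_vector[OF prob_space_axioms basis indep X dist tm
            has_integral_covariance_op[OF X X4] n]) simp
    then show "(\<integral>\<^sup>+\<omega>. ennreal (if j \<in> J then (norm (K_hat Xs n \<omega> (v j) - covariance_op M X (v j)))\<^sup>2 else 0) \<partial>M)
       \<le> ennreal (1 / real n) * (\<integral>\<^sup>+\<omega>. ennreal (if j \<in> J then (norm (tensor_sq (X \<omega>) (v j)))\<^sup>2 else 0) \<partial>M)"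
      by (cases "j \<in> J") (simp_all only: if_True if_False, simp)
  qed auto
  also have "\<dots> = ennreal (1 / real n) * (\<Sum>j. \<integral>\<^sup>+\<omega>. ennreal (if j \<in> J then (norm (tensor_sq (X \<omega>) (v j)))\<^sup>2 else 0) \<partial>M)"
    by (rule ennreal_suminf_cmult)
  also have "(\<Sum>j. \<integral>\<^sup>+\<omega>. ennreal (if j \<in> J then (norm (tensor_sq (X \<omega>) (v j)))\<^sup>2 else 0) \<partial>M)
      = (\<integral>\<^sup>+\<omega>. (\<Sum>j. ennreal (if j \<in> J then (norm (tensor_sq (X \<omega>) (v j)))\<^sup>2 else 0)) \<partial>M)"
    unfolding tensor_sq_def by (rule nn_integral_suminf[symmetric]) measurable
  also have "\<dots> = (\<integral>\<^sup>+\<omega>. ennreal (norm (X \<omega>) ^ 4) \<partial>M)"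
  proof (rule nn_integral_cong)
    fix \<omega>
    have "ennreal (if j \<in> J then (norm (tensor_sq (X \<omega>) (v j)))\<^sup>2 else 0)
      = ennreal ((norm (X \<omega>))\<^sup>2) * ennreal (if j \<in> J then (v j \<bullet> X \<omega>)\<^sup>2 else 0)" for j
      by (simp add: tensor_sq_def power_mult_distrib inner_commute ennreal_mult mult.commute)
    then have "(\<Sum>j. ennreal (if j \<in> J then (norm (tensor_sq (X \<omega>) (v j)))\<^sup>2 else 0))
      = ennreal ((norm (X \<omega>))\<^sup>2) * ennreal ((norm (X \<omega>))\<^sup>2)"
      unfolding ennreal_parseval[of "X \<omega>"] by (simp only: ennreal_suminf_cmult)
    then show "(\<Sum>j. ennreal (if j \<in> J then (norm (tensor_sq (X \<omega>) (v j)))\<^sup>2 else 0)) = ennreal (norm (X \<omega>) ^ 4)"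
      by (simp flip: ennreal_mult power_add)
  qed
  also have "\<dots> = ennreal (\<integral>\<omega>. norm (X \<omega>) ^ 4 \<partial>M)"
    by (rule nn_integral_eq_integral[OF X4]) simp
  finally show "(\<integral>\<^sup>+\<omega>. (\<Sum>j. ennreal (if j \<in> J then (norm (K_hat Xs n \<omega> (v j) - covariance_op M X (v j)))\<^sup>2 else 0)) \<partial>M)
      \<le> ennreal (1 / real n) * ennreal (\<integral>\<omega>. norm (X \<omega>) ^ 4 \<partial>M)" .
qed

text \<open>The noise of an observation is the function \<open>(y - \<beta> \<bullet> x) x\<close> of the pair \<open>(x, y)\<close>, so it has the
distribution of \<open>e X\<close>, which has mean zero.\<close>

lemma noise_variance:
  fixes X :: "'a \<Rightarrow> 'h::{real_inner, banach, second_countable_topology}"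
  assumes basis: "eigenbasis K J lam (v :: nat \<Rightarrow> 'h)"
    and X: "X \<in> borel_measurable M" and Y: "Y \<in> borel_measurable M" and e: "e \<in> borel_measurable M"
    and X2: "integrable M (\<lambda>\<omega>. (norm (X \<omega>))\<^sup>2)"
    and indep: "indep_vars (\<lambda>_. borel) (\<lambda>i \<omega>. (Xs i \<omega>, Ys i \<omega>)) {1..}"
    and dist: "\<And>i. 1 \<le> i \<Longrightarrow> distr M borel (\<lambda>\<omega>. (Xs i \<omega>, Ys i \<omega>)) = distr M borel (\<lambda>\<omega>. (X \<omega>, Y \<omega>))"
    and model: "\<And>\<omega>. \<omega> \<in> space M \<Longrightarrow> Y \<omega> = \<beta> \<bullet> X \<omega> + e \<omega>"
    and ortho: "has_bochner_integral M (\<lambda>\<omega>. e \<omega> *\<^sub>R X \<omega>) 0"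
    and cond: "AE \<omega> in M. nn_cond_exp M (vimage_algebra (space M) X borel)
           (\<lambda>\<omega>. ennreal ((e \<omega>)\<^sup>2)) \<omega> \<le> ennreal (\<sigma>\<^sup>2)"
    and n: "1 \<le> n"
  shows "(\<lambda>\<omega>. ennreal ((norm ((1 / real n) *\<^sub>R (\<Sum>i=1..n. (Ys i \<omega> - \<beta> \<bullet> Xs i \<omega>) *\<^sub>R Xs i \<omega>)))\<^sup>2)) \<in> borel_measurable M"
    and "(\<integral>\<^sup>+\<omega>. ennreal ((norm ((1 / real n) *\<^sub>R (\<Sum>i=1..n. (Ys i \<omega> - \<beta> \<bullet> Xs i \<omega>) *\<^sub>R Xs i \<omega>)))\<^sup>2) \<partial>M)
      \<le> ennreal (1 / real n) * ennreal (\<sigma>\<^sup>2 * (\<integral>\<omega>. (norm (X \<omega>))\<^sup>2 \<partial>M))"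
proof -
  note [measurable] = X Y e
  define g where "g p = (snd p - \<beta> \<bullet> fst p) *\<^sub>R fst p" for p :: "'h \<times> real"
  have g: "g \<in> borel_measurable borel"
    unfolding g_def by (intro borel_measurable_continuous_onI continuous_intros)
  have W: "(\<lambda>\<omega>. (Xs i \<omega>, Ys i \<omega>)) \<in> borel_measurable M" if "1 \<le> i" for i
    using indep that by (auto simp: indep_vars_def2)
  have "(\<lambda>\<omega>. \<Sum>i=1..n. g (Xs i \<omega>, Ys i \<omega>)) \<in> borel_measurable M"
    by (rule borel_measurable_sum) (use measurable_compose[OF W g] in simp)
  then show "(\<lambda>\<omega>. ennreal ((norm ((1 / real n) *\<^sub>R (\<Sum>i=1..n. (Ys i \<omega> - \<beta> \<bullet> Xs i \<omega>) *\<^sub>R Xs i \<omega>)))\<^sup>2)) \<in> borel_measurable M"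
    unfolding g_def fst_conv snd_conv by measurable
  have ge: "g (X \<omega>, Y \<omega>) = e \<omega> *\<^sub>R X \<omega>" if "\<omega> \<in> space M" for \<omega>
    using model[OF that] by (simp add: g_def)
  have c: "has_bochner_integral M (\<lambda>\<omega>. g (X \<omega>, Y \<omega>)) 0"
    using ortho by (subst has_bochner_integral_cong[OF refl ge refl])
  have W0: "(\<lambda>\<omega>. (X \<omega>, Y \<omega>)) \<in> borel_measurable M" by (rule borel_measurable_Pair[OF X Y])
  have "(\<integral>\<^sup>+\<omega>. ennreal ((norm ((1 / real n) *\<^sub>R (\<Sum>i=1..n. (Ys i \<omega> - \<beta> \<bullet> Xs i \<omega>) *\<^sub>R Xs i \<omega>)))\<^sup>2) \<partial>M)
      \<le> ennreal (1 / real n) * (\<integral>\<^sup>+\<omega>. ennreal ((norm (g (X \<omega>, Y \<omega>)))\<^sup>2) \<partial>M)"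
    using sample_mean_variance_vector[OF prob_space_axioms basis indep W0 dist g c n]
    by (simp only: g_def fst_conv snd_conv diff_zero)
  also have "(\<integral>\<^sup>+\<omega>. ennreal ((norm (g (X \<omega>, Y \<omega>)))\<^sup>2) \<partial>M)
      = (\<integral>\<^sup>+\<omega>. ennreal ((norm (X \<omega>))\<^sup>2) * ennreal ((e \<omega>)\<^sup>2) \<partial>M)"
    by (rule nn_integral_cong) (simp add: ge power_mult_distrib mult.commute flip: ennreal_mult)
  also have "\<dots> \<le> ennreal (\<sigma>\<^sup>2) * (\<integral>\<^sup>+\<omega>. ennreal ((norm (X \<omega>))\<^sup>2) \<partial>M)"
    by (rule conditional_second_moment[OF X _ _ cond]) measurable
  also have "(\<integral>\<^sup>+\<omega>. ennreal ((norm (X \<omega>))\<^sup>2) \<partial>M) = ennreal (\<integral>\<omega>. (norm (X \<omega>))\<^sup>2 \<partial>M)"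
    by (rule nn_integral_eq_integral[OF X2]) simp
  also have "ennreal (\<sigma>\<^sup>2) * ennreal (\<integral>\<omega>. (norm (X \<omega>))\<^sup>2 \<partial>M) = ennreal (\<sigma>\<^sup>2 * (\<integral>\<omega>. (norm (X \<omega>))\<^sup>2 \<partial>M))"
    by (rule ennreal_mult[symmetric]) simp_all
  finally show "(\<integral>\<^sup>+\<omega>. ennreal ((norm ((1 / real n) *\<^sub>R (\<Sum>i=1..n. (Ys i \<omega> - \<beta> \<bullet> Xs i \<omega>) *\<^sub>R Xs i \<omega>)))\<^sup>2) \<partial>M)
      \<le> ennreal (1 / real n) * ennreal (\<sigma>\<^sup>2 * (\<integral>\<omega>. (norm (X \<omega>))\<^sup>2 \<partial>M))"
    by (simp add: mult_left_mono)
qed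

end

lemma (in eigenbasis) hilbert_schmidt_diff_bound:
  assumes sa: "\<And>x y. A x \<bullet> y = x \<bullet> A y"
    and HS: "(\<Sum>j. ennreal (if j \<in> J then (norm (A (v j) - K (v j)))\<^sup>2 else 0)) \<le> ennreal (h\<^sup>2)" and h: "0 \<le> h"
  shows "norm (K x - A x) \<le> h * norm x"
proof -
  have "norm (A x - K x) \<le> h * norm x"
  proof (rule hilbert_schmidt_bound[where T = "\<lambda>x. A x - K x"])
    fix j assume j: "j \<in> J"
    show "v j \<bullet> (A x - K x) = (A (v j) - K (v j)) \<bullet> x"
      by (simp add: inner_diff_right inner_diff_left inner_K[OF j] K_eigenvector[OF j] sa)
  next
    fix F assume F: "finite F" "F \<subseteq> J"
    have "ennreal (\<Sum>j\<in>F. (norm (A (v j) - K (v j)))\<^sup>2) = (\<Sum>j\<in>F. ennreal (if j \<in> J then (norm (A (v j) - K (v j)))\<^sup>2 else 0))"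
    proof -
      have "(\<Sum>j\<in>F. (norm (A (v j) - K (v j)))\<^sup>2) = (\<Sum>j\<in>F. if j \<in> J then (norm (A (v j) - K (v j)))\<^sup>2 else 0)"
        by (intro sum.cong) (use F in auto)
      then show ?thesis by simp
    qed
    also have "\<dots> \<le> (\<Sum>j. ennreal (if j \<in> J then (norm (A (v j) - K (v j)))\<^sup>2 else 0))"
      by (rule sum_le_suminf) (use F in auto)
    also have "\<dots> \<le> ennreal (h\<^sup>2)" by (rule HS)
    finally show "(\<Sum>j\<in>F. (norm (A (v j) - K (v j)))\<^sup>2) \<le> h\<^sup>2" by simp
  qed (rule h)
  then show ?thesis by (simp add: norm_minus_commute)
qed

lemma eventually_measure_compl_le:
  assumes "prob_space M" "\<And>n. E n \<in> sets M" "(\<lambda>n. measure M (E n)) \<longlonglongrightarrow> 1" "0 < \<epsilon>"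
  shows "\<forall>\<^sub>F n in sequentially. measure M (space M - E n) \<le> \<epsilon>"
proof -
  interpret prob_space M by fact
  have "\<forall>\<^sub>F n in sequentially. 1 - \<epsilon> < measure M (E n)"
    by (rule order_tendstoD(1)[OF assms(3)]) (use assms(4) in simp)
  then show ?thesis by (rule eventually_mono) (use assms(2) in \<open>simp add: prob_compl\<close>)
qed

lemma measure_Un4_le:
  assumes "A \<in> sets M" "B \<in> sets M" "C \<in> sets M" "D \<in> sets M"
  shows "measure M (A \<union> B \<union> C \<union> D) \<le> measure M A + measure M B + measure M C + measure M D"
proof -
  have "measure M (A \<union> B \<union> C \<union> D) \<le> measure M (A \<union> B \<union> C) + measure M D"
    and "measure M (A \<union> B \<union> C) \<le> measure M (A \<union> B) + measure M C"
    and "measure M (A \<union> B) \<le> measure M A + measure M B"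
    using assms by (auto intro!: measure_Un_le)
  then show ?thesis by linarith
qed

section \<open>The rate in probability\<close>

theorem theorem1:
  fixes M :: "'w measure"
    and X :: "'w \<Rightarrow> 'h::{real_inner, banach, second_countable_topology}"
    and Y eps :: "'w \<Rightarrow> real"
    and Xs :: "nat \<Rightarrow> 'w \<Rightarrow> 'h"
    and Ys :: "nat \<Rightarrow> 'w \<Rightarrow> real"
    and \<beta> :: 'h
    and \<sigma> \<mu> R C s :: real
    and J :: "nat set" and lam :: "nat \<Rightarrow> real" and v :: "nat \<Rightarrow> 'h"
    and m :: "nat \<Rightarrow> 'w \<Rightarrow> nat"
    and Q :: "nat \<Rightarrow> 'w \<Rightarrow> real poly"
  assumes "prob_space M"
    and "X \<in> borel_measurable M" and "Y \<in> borel_measurable M" and "eps \<in> borel_measurable M"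
    and iid: "prob_space.indep_vars M (\<lambda>_. borel) (\<lambda>i \<omega>. (Xs i \<omega>, Ys i \<omega>)) {1..}"
      "\<And>i. i \<ge> 1 \<Longrightarrow>
         distr M borel (\<lambda>\<omega>. (Xs i \<omega>, Ys i \<omega>)) = distr M borel (\<lambda>\<omega>. (X \<omega>, Y \<omega>))"
    and model: "\<And>\<omega>. \<omega> \<in> space M \<Longrightarrow> Y \<omega> = \<beta> \<bullet> X \<omega> + eps \<omega>"
    and "has_bochner_integral M (\<lambda>\<omega>. eps \<omega> *\<^sub>R X \<omega>) 0"
    and "has_bochner_integral M X 0"
    and "integrable M (\<lambda>\<omega>. norm (X \<omega>) ^ 4)"
    and "AE \<omega> in M. nn_cond_exp M (vimage_algebra (space M) X borel)
           (\<lambda>\<omega>. ennreal ((eps \<omega>)\<^sup>2)) \<omega> \<le> ennreal (\<sigma>\<^sup>2)"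
    and spectral: "spectral_decomposition (covariance_op M X) J lam v"
    and no_zero_eigenvalue: "\<not> is_eigenvalue (covariance_op M X) 0"
    and "\<mu> > 0" and "R > 0" and "C > 0"
    and source: "(\<lambda>j. (\<beta> \<bullet> v j)\<^sup>2 / (lam j powr (2 * \<mu>))) summable_on J"
      "(\<Sum>\<^sub>\<infinity>j\<in>J. (\<beta> \<bullet> v j)\<^sup>2 / (lam j powr (2 * \<mu>))) \<le> R\<^sup>2"
    and trace: "lam summable_on J" "(\<Sum>\<^sub>\<infinity>j\<in>J. lam j) \<le> C"
    and residual: "with_prob_tending_to_1 M (\<lambda>n \<omega>.
        1 \<le> m n \<omega> \<and> m n \<omega> \<le> num_nonzero_eigenvalues (K_hat Xs n \<omega>) \<and>
        is_residual_poly (K_hat Xs n \<omega>) (r_hat Xs Ys n \<omega>) (m n \<omega>) (Q n \<omega>) \<and>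
        card {t. poly (Q n \<omega>) t = 0} = m n \<omega> \<and>
        (\<forall>t. poly (Q n \<omega>) t = 0 \<longrightarrow> t > 0))"
    and "O_P M (\<lambda>n \<omega>. \<bar>poly (pderiv (Q n \<omega>)) 0\<bar>) (\<lambda>n \<omega>. real n powr (1/2))"
    and "0 \<le> s" and "s \<le> 1"
  shows "O_P M
     (\<lambda>n \<omega>. (norm (op_powr J lam v s
        (pls (K_hat Xs n \<omega>) (r_hat Xs Ys n \<omega>) (m n \<omega>) - \<beta>)))\<^sup>2)
     (\<lambda>n \<omega>.
        \<bar>poly (pderiv (Q n \<omega>)) 0\<bar> powr (2 * (1 - s)) * real n powr (-1)
      + \<bar>poly (pderiv (Q n \<omega>)) 0\<bar> powr (- 2 * (\<mu> + s))
      + \<bar>poly (pderiv (Q n \<omega>)) 0\<bar> powr (- 2 * s) * real n powr (- min \<mu> 1))"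
proof -
  interpret prob_space M by fact
  note [measurable] = assms(2-4)
  have basis: "eigenbasis (covariance_op M X) J lam v"
    using spectral no_zero_eigenvalue by (rule eigenbasis.intro)
  interpret eigenbasis "covariance_op M X" J lam v by (rule basis)
  define noise where "noise n \<omega> = (1 / real n) *\<^sub>R (\<Sum>i=1..n. (Ys i \<omega> - \<beta> \<bullet> Xs i \<omega>) *\<^sub>R Xs i \<omega>)" for n \<omega>
  define hs where "hs n \<omega> = (\<Sum>j. ennreal (if j \<in> J then
    (norm (K_hat Xs n \<omega> (v j) - covariance_op M X (v j)))\<^sup>2 else 0))" for n \<omega>
  have pair: "(\<lambda>\<omega>. (Xs i \<omega>, Ys i \<omega>)) \<in> borel_measurable M" if "1 \<le> i" for i
    using iid(1) that by (auto simp: indep_vars_def2)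
  have fst_m: "fst \<in> borel_measurable (borel :: ('h \<times> real) measure)"
    by (intro borel_measurable_continuous_onI continuous_intros)
  have X_indep: "indep_vars (\<lambda>_. borel) Xs {1..}"
    using indep_vars_compose2[OF iid(1), of "\<lambda>_. fst" "\<lambda>_. borel"] fst_m by simp
  have X_dist: "distr M borel (Xs i) = distr M borel X" if i: "1 \<le> i" for i
    using arg_cong[OF iid(2)[OF i], of "\<lambda>N. distr N borel fst"]
    by (simp add: distr_distr[OF fst_m pair[OF i]] distr_distr[OF fst_m borel_measurable_Pair] assms(2,3) comp_def)
  show ?thesis
    unfolding O_P_def
  proof (intro allI impI)
    fix \<epsilon> :: real assume "0 < \<epsilon>"
    then have e4: "0 < \<epsilon> / 4" by simp
    obtain t1 where t1: "0 < t1" "\<And>n. 1 \<le> n \<Longrightarrow> \<exists>E\<in>sets M. measure M E \<le> \<epsilon> / 4 \<and>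
        (\<forall>\<omega>\<in>space M - E. ennreal ((norm (noise n \<omega>))\<^sup>2) \<le> ennreal (t1 / real n))"
    proof (rule markov_rate[OF _ _ e4])
      fix n :: nat assume n: "1 \<le> n"
      note nv = noise_variance[OF basis assms(2-4) integrable_norm_square[OF assms(2,10)] iid model assms(8,11) n]
      show "(\<lambda>\<omega>. ennreal ((norm (noise n \<omega>))\<^sup>2)) \<in> borel_measurable M"
        unfolding noise_def by (rule nv(1))
      show "(\<integral>\<^sup>+\<omega>. ennreal ((norm (noise n \<omega>))\<^sup>2) \<partial>M)
          \<le> ennreal (1 / real n) * ennreal (\<sigma>\<^sup>2 * (\<integral>\<omega>. (norm (X \<omega>))\<^sup>2 \<partial>M))"
        unfolding noise_def by (rule nv(2))
    qed blast
    obtain t2 where t2: "0 < t2" "\<And>n. 1 \<le> n \<Longrightarrow> \<exists>E\<in>sets M. measure M E \<le> \<epsilon> / 4 \<and>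
        (\<forall>\<omega>\<in>space M - E. hs n \<omega> \<le> ennreal (t2 / real n))"
    proof (rule markov_rate[OF _ _ e4])
      fix n :: nat assume n: "1 \<le> n"
      note kv = K_hat_hilbert_schmidt_variance[OF basis assms(2,10) X_indep X_dist n]
      show "hs n \<in> borel_measurable M" unfolding hs_def by (rule kv(1))
      show "(\<integral>\<^sup>+\<omega>. hs n \<omega> \<partial>M) \<le> ennreal (1 / real n) * ennreal (\<integral>\<omega>. norm (X \<omega>) ^ 4 \<partial>M)"
        unfolding hs_def by (rule kv(2))
    qed blast
    obtain c3 where c3: "\<forall>\<^sub>F n in sequentially. \<exists>E\<in>sets M.
        {\<omega> \<in> space M. \<bar>\<bar>poly (pderiv (Q n \<omega>)) 0\<bar>\<bar> > c3 * real n powr (1/2)} \<subseteq> E \<and> measure M E \<le> \<epsilon> / 4"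
      using assms(22) e4 unfolding O_P_def by blast
    obtain Eg where Eg: "\<And>n. Eg n \<in> sets M" "(\<lambda>n. measure M (Eg n)) \<longlonglongrightarrow> 1"
      and good: "\<And>n \<omega>. \<omega> \<in> Eg n \<Longrightarrow> 1 \<le> m n \<omega> \<and>
        is_residual_poly (K_hat Xs n \<omega>) (r_hat Xs Ys n \<omega>) (m n \<omega>) (Q n \<omega>) \<and>
        card {t. poly (Q n \<omega>) t = 0} = m n \<omega> \<and> (\<forall>t. poly (Q n \<omega>) t = 0 \<longrightarrow> t > 0)"
      using residual unfolding with_prob_tending_to_1_def by blast
    have ev4: "\<forall>\<^sub>F n in sequentially. measure M (space M - Eg n) \<le> \<epsilon> / 4"
      by (rule eventually_measure_compl_le[OF assms(1) Eg e4])
    \<comment> \<open>One constant for the three events, as the deterministic bound asks for; \<open>c3\<close> may be negative.\<close>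
    define G where "G = max (max (sqrt t1) (sqrt t2)) \<bar>c3\<bar>"
    have G: "0 \<le> G" "sqrt t1 \<le> G" "sqrt t2 \<le> G" "c3 \<le> G" by (auto simp: G_def)
    \<comment> \<open>Bounds both \<open>\<parallel>K\<parallel>\<close>, by the trace, and \<open>\<parallel>A\<parallel>\<close>, since \<open>\<parallel>K - A\<parallel> \<le> G * d\<close> and \<open>d \<le> 1\<close>.\<close>
    define D where "D = max 1 C + G"
    show "\<exists>c. \<forall>\<^sub>F n in sequentially. \<exists>E\<in>sets M.
        {\<omega> \<in> space M. \<bar>(norm (op_powr J lam v s
            (pls (K_hat Xs n \<omega>) (r_hat Xs Ys n \<omega>) (m n \<omega>) - \<beta>)))\<^sup>2\<bar> > c *
          (\<bar>poly (pderiv (Q n \<omega>)) 0\<bar> powr (2 * (1 - s)) * real n powr (-1)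
          + \<bar>poly (pderiv (Q n \<omega>)) 0\<bar> powr (- 2 * (\<mu> + s))
          + \<bar>poly (pderiv (Q n \<omega>)) 0\<bar> powr (- 2 * s) * real n powr (- min \<mu> 1))} \<subseteq> E \<and> measure M E \<le> \<epsilon>"
    proof (rule exI[of _ "pls_const \<mu> R D G"], use c3 ev4 eventually_ge_at_top[of 1] in eventually_elim)
      case (elim n)
      obtain E1 where E1: "E1 \<in> sets M" "measure M E1 \<le> \<epsilon> / 4"
        "\<And>\<omega>. \<omega> \<in> space M - E1 \<Longrightarrow> ennreal ((norm (noise n \<omega>))\<^sup>2) \<le> ennreal (t1 / real n)"
        using t1(2)[OF elim(3)] by blast
      obtain E2 where E2: "E2 \<in> sets M" "measure M E2 \<le> \<epsilon> / 4"
        "\<And>\<omega>. \<omega> \<in> space M - E2 \<Longrightarrow> hs n \<omega> \<le> ennreal (t2 / real n)"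
        using t2(2)[OF elim(3)] by blast
      obtain E3 where E3: "E3 \<in> sets M" "measure M E3 \<le> \<epsilon> / 4"
        "{\<omega> \<in> space M. \<bar>\<bar>poly (pderiv (Q n \<omega>)) 0\<bar>\<bar> > c3 * real n powr (1/2)} \<subseteq> E3"
        using elim(1) by blast
      define E where "E = E1 \<union> E2 \<union> E3 \<union> (space M - Eg n)"
      define d where "d = real n powr (- 1 / 2)"
      have n: "0 < real n" "1 \<le> real n" using elim(3) by auto
      have d: "0 < d" "d \<le> 1"
        using n powr_mono[of "- 1 / 2" 0 "real n"] by (auto simp: d_def)
      have d2: "d\<^sup>2 = real n powr (- 1)" "d powr (2 * min \<mu> 1) = real n powr (- min \<mu> 1)"
        by (simp_all add: d_def power2_eq_square powr_powr flip: powr_add)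
      have sqrt_n: "sqrt (t / real n) = sqrt t * d" for t
      proof -
        have "d = 1 / sqrt (real n)"
          using n powr_minus_divide[of "real n" "1 / 2"] by (simp add: d_def powr_half_sqrt)
        then show ?thesis by (simp add: real_sqrt_divide)
      qed
      have "E \<in> sets M" unfolding E_def using E1 E2 E3 Eg by auto
      moreover have "measure M E \<le> \<epsilon>"
        unfolding E_def using measure_Un4_le[OF E1(1) E2(1) E3(1), of "space M - Eg n"] E1(2) E2(2) E3(2) elim(2) Eg(1)
        by simp
      moreover have "\<bar>(norm (op_powr J lam v s (pls (K_hat Xs n \<omega>) (r_hat Xs Ys n \<omega>) (m n \<omega>) - \<beta>)))\<^sup>2\<bar>
          \<le> pls_const \<mu> R D G * (\<bar>poly (pderiv (Q n \<omega>)) 0\<bar> powr (2 * (1 - s)) * real n powr (-1)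
          + \<bar>poly (pderiv (Q n \<omega>)) 0\<bar> powr (- 2 * (\<mu> + s))
          + \<bar>poly (pderiv (Q n \<omega>)) 0\<bar> powr (- 2 * s) * real n powr (- min \<mu> 1))"
        if \<omega>: "\<omega> \<in> space M" "\<omega> \<notin> E" for \<omega>
      proof -
        have \<omega>': "\<omega> \<in> space M - E1" "\<omega> \<in> space M - E2" "\<omega> \<notin> E3" "\<omega> \<in> Eg n"
          using \<omega> by (auto simp: E_def)
        obtain S F where spec: "spectral_resolution (K_hat Xs n \<omega>) S F" by (rule K_hat_spectral_resolution)
        then interpret A: spectral_resolution "K_hat Xs n \<omega>" S F .
        have "(norm (noise n \<omega>))\<^sup>2 \<le> t1 / real n"
          using E1(3)[OF \<omega>'(1)] t1(1) n by simp
        then have "norm (noise n \<omega>) \<le> sqrt t1 * d"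
          unfolding sqrt_n[symmetric] by (rule real_le_rsqrt)
        also have "\<dots> \<le> G * d" using G d by simp
        finally have noise: "norm (noise n \<omega>) \<le> G * d" .
        have diff: "norm (covariance_op M X x - K_hat Xs n \<omega> x) \<le> G * d * norm x" for x
        proof (rule hilbert_schmidt_diff_bound[OF A.selfadjoint])
          have "t2 / real n = (sqrt t2 * d)\<^sup>2"
            unfolding sqrt_n[symmetric] using t2(1) n by simp
          also have "\<dots> \<le> (G * d)\<^sup>2" using G d t2(1) by (intro power_mono mult_right_mono) auto
          finally have "ennreal (t2 / real n) \<le> ennreal ((G * d)\<^sup>2)" by (rule ennreal_leI)
          then show "(\<Sum>j. ennreal (if j \<in> J then (norm (K_hat Xs n \<omega> (v j) - covariance_op M X (v j)))\<^sup>2 else 0))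
              \<le> ennreal ((G * d)\<^sup>2)"
            using E2(3)[OF \<omega>'(2)] unfolding hs_def by (rule order_trans[rotated])
        qed (use G d in simp)
        have lam_sum: "sum lam F \<le> C" if "finite F" "F \<subseteq> J" for F
          by (rule order_trans[OF finite_sum_le_infsum[OF trace(1) that] trace(2)]) (simp add: lam_nonneg)
        have lam_C: "lam j \<le> C" if "j \<in> J" for j using lam_sum[of "{j}"] that by simp
        have A_le: "norm (K_hat Xs n \<omega> x) \<le> D * norm x" for x
        proof -
          have "norm (covariance_op M X x) \<le> max 1 C * norm x"
            by (rule norm_K_le) (use lam_C in \<open>auto intro: max.coboundedI2\<close>)
          moreover have "G * d * norm x \<le> G * norm x"
            using G(1) d by (intro mult_right_mono) (auto intro: mult_left_le)
          moreover have "norm (K_hat Xs n \<omega> x) \<le> norm (covariance_op M X x) + norm (covariance_op M X x - K_hat Xs n \<omega> x)"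
            using norm_triangle_sub[of "K_hat Xs n \<omega> x" "covariance_op M X x"] by (simp add: norm_minus_commute)
          ultimately show ?thesis using diff[of x] by (simp add: D_def distrib_right)
        qed
        have slope: "\<bar>poly (pderiv (Q n \<omega>)) 0\<bar> * d \<le> G"
        proof -
          have "\<bar>poly (pderiv (Q n \<omega>)) 0\<bar> \<le> c3 * real n powr (1/2)"
          proof (rule ccontr)
            assume "\<not> ?thesis"
            then have "\<omega> \<in> E3" using \<omega>(1) by (intro subsetD[OF E3(3)]) simp
            then show False using \<omega>'(3) by contradiction
          qed
          then have "\<bar>poly (pderiv (Q n \<omega>)) 0\<bar> * d \<le> c3 * real n powr (1/2) * d"
            using d by (intro mult_right_mono) auto
          also have "\<dots> = c3" using n by (simp add: d_def mult.assoc flip: powr_add)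
          finally show ?thesis using G by simp
        qed
        interpret B: pls_perturbation "covariance_op M X" J lam v "K_hat Xs n \<omega>" S F \<beta>
          "r_hat Xs Ys n \<omega>" "noise n \<omega>" \<mu> R D G d "m n \<omega>" "Q n \<omega>"
        proof unfold_locales
          show "sum (\<lambda>j. (\<beta> \<bullet> v j)\<^sup>2 / (lam j powr (2 * \<mu>))) F \<le> R\<^sup>2" if "finite F" "F \<subseteq> J" for F
            by (rule order_trans[OF finite_sum_le_infsum[OF source(1) that] source(2)]) simp
          show "finite {j \<in> J. a < lam j}" if "0 < a" for a
            using finite_lam_above[of C a] lam_sum that by blast
          show "r_hat Xs Ys n \<omega> = K_hat Xs n \<omega> \<beta> + noise n \<omega>"
            unfolding noise_def by (rule r_hat_eq)
          show "lam j \<le> D" if "j \<in> J" for j using lam_C[OF that] G(1) by (simp add: D_def)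
          show "1 \<le> D" using G(1) by (simp add: D_def)
          show "0 < t" if "poly (Q n \<omega>) t = 0" for t using good[OF \<omega>'(4)] that by blast
          show "0 \<le> R" using assms(15) by simp
        qed (fact | rule assms(14) G(1) d(1) A_le noise diff slope | use good[OF \<omega>'(4)] in blast)+
        show ?thesis
          using B.pls_error_bound[OF assms(23,24) refl] by (simp only: d2 abs_power2)
      qed
      ultimately show ?case by (intro bexI[of _ E] conjI subsetI) (simp_all, meson not_less)
    qed
  qed
qed

end
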